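(* Suppose a codeword $\mathbf{x}\in C$ is transmitted, and $\mathbf{y}=\mathbf{x}+\mathbf{e}$ is received. Let $0\to F_1\to W\to F_2\to 0$ be the extension of $F_2$ by $F_1$ defined by the syndrome class $\nu(\mathbf{y})=\nu(\mathbf{e})\in H^1(X,\mathrm{Hom}(F_2,F_1))$. Then the error $\mathbf{e}$ has weight at most $h$ only if $W$ has a subbundle, necessarily of degree at least $\deg(F_2)-h$, lifting from an elementary transformation $\mathcal{G}$ of $F_2$ of the form $$0\to\mathcal{G}\to\mathcal{F}_2\to\tau\to 0,$$ where $\tau\subset\underline{\mathrm{Prin}}(F_1)$ is a skyscraper sheaf of length at most $h$, supported on $D$ and with at most simple poles.
   Context: Let $X$ be a smooth projective geometrically irreducible curve over the finite field $\mathbb{F}_q$, and let $D=x_1+\cdots+x_s$ be a sum of distinct $\mathbb{F}_q$-rational points of $X$. The sheaf of sections of a vector bundle $F$ is denoted by the script letter $\mathcal{F}$. Principal parts: for a vector bundle $V\to X$ there is a short exact sequence of $\mathcal{O}_X$-modules $0\to\mathcal{V}\to\underline{\mathrm{Rat}}(V)\to\underline{\mathrm{Prin}}(V)\to 0$, where $\underline{\mathrm{Rat}}(V)$ is the sheaf of rational sections of $V$ and $\underline{\mathrm{Prin}}(V)$ is the sheaf of $V$-valued principal parts. Taking global sections gives $0\to H^0(X,V)\to\mathrm{Rat}(V)\to\mathrm{Prin}(V)\to H^1(X,V)\to 0$; the class in $H^1(X,V)$ of $p\in\mathrm{Prin}(V)$ is denoted $[p]$. A subsheaf of $\underline{\mathrm{Prin}}(F_1)$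 is supported on $D$ with at most simple poles if it is contained in $\mathcal{F}_1(D)/\mathcal{F}_1$. The code: let $F_1,F_2$ be vector bundles over $X$, let $H^*=\mathrm{Hom}(F_2,F_1)$, of rank $r$, and let $E=H^*(D)$. Assume that $\mathcal{O}_{\mathbb{P}E}(1)$ is very ample on $\mathbb{P}E$ (the projective bundle of codimension one subspaces of the fibers of $E$) and that $h^1(X,E)=h^0(X,E(-D))=0$. The global sections of $H^*(D)|_D=\mathcal{H}^*(D)/\mathcal{H}^*$ are the $H^*$-valued principal parts supported on $D$ with at most simple poles. Let $p_{i,j}$ ($1\le i\le s$, $1\le j\le r$) be an $\mathbb{F}_q$-basis of this space such that each $p_{i,j}$ is supported at $x_i$ with a simple pole along a direction corresponding to a homomorphism of rank one in $\mathrm{Hom}(F_2,F_1)|_{x_i}$. Identify $\mathbb{F}_q^{sr}$ with $\bigoplus_{i,j}\mathbb{F}_q\cdot p_{i,j}$. The code $C\subset\mathbb{F}_q^{sr}$ is the image of the principal part map $\rho:H^0(X,H^*(D))\to H^*(D)|_D$; the syndrome map is $\nu:\mathbb{F}_q^{sr}\to H^1(X,H^* )$, $\nu(\sum\lambda_{i,j}p_{i,j})=[\sum\lambda_{i,j}p_{i,j}]$, and the sequence $0\to H^0(X,H^*(D))\xrightarrow{\rho}\mathbb{F}_q^{sr}\xrightarrow{\nu}H^1(X,H^* )\to 0$ is exact. The weight of $\mathbf{e}=\sum\lambda_{i,j}p_{i,j}$ is the number of nonzero $\lambda_{i,j}$. Extensions of $F_2$ by $F_1$ are classified by $H^1(X,\mathrm{Hom}(F_2,F_1))$.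 Elementary transformations: an elementary transformation of $F_2$ is a vector bundle defined by a locally free subsheaf $\mathcal{G}\subset\mathcal{F}_2$ of rank equal to the rank of $F_2$. It lifts to a subbundle of $W$ if the inclusion $\mathcal{G}\hookrightarrow\mathcal{F}_2$ factors through $\mathcal{W}\to\mathcal{F}_2$ in such a way that $\mathcal{G}$ is the sheaf of sections of a vector subbundle of $W$ (i.e. the quotient of $\mathcal{W}$ by $\mathcal{G}$ is locally free). *)

theory Defs
  imports
    "HOL-Analysis.Analysis"
    "HOL-Library.Poly_Mapping"
    "HOL-Library.Extended_Nat"
    "HOL-Computational_Algebra.Polynomial"
    "HOL-Computational_Algebra.Fraction_Field"
begin

section \<open>Integral separated schemes inside a field\<close>

text \<open>
  An integral separated scheme with function field \<open>K\<close> is determined by the set of its local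
  rings, which are subrings of \<open>K\<close>, and distinct points have distinct local rings (these are
  the \<^emph>\<open>schemata\<close> of Chevalley, EGA I, 8.1--8.3).  Such a scheme is given here
  as a set of local subrings of a field: a point \<^emph>\<open>is\<close> its local ring.  Since \<open>K\<close> is
  a type, the generic point of a scheme with function field \<open>K\<close> is \<open>UNIV\<close>.
\<close>

definition subring_of_field :: "'a::field set \<Rightarrow> bool" where
  "subring_of_field A \<longleftrightarrow> 1 \<in> A \<and> (\<forall>a\<in>A. \<forall>b\<in>A. a - b \<in> A \<and> a * b \<in> A)"

definition adjoin :: "'a::field set \<Rightarrow> 'a set \<Rightarrow> 'a set" where
  "adjoin A S = \<Inter>{B. subring_of_field B \<and> A \<subseteq> B \<and> S \<subseteq> B}"

definition prime_ideal_of :: "'a::field set \<Rightarrow> 'a set \<Rightarrow> bool" where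
  "prime_ideal_of A P \<longleftrightarrow>
     P \<subseteq> A \<and> 0 \<in> P \<and> 1 \<notin> P \<and>
     (\<forall>a\<in>P. \<forall>b\<in>P. a + b \<in> P) \<and> (\<forall>a\<in>A. \<forall>b\<in>P. a * b \<in> P) \<and>
     (\<forall>a\<in>A. \<forall>b\<in>A. a * b \<in> P \<longrightarrow> a \<in> P \<or> b \<in> P)"

definition localization_at :: "'a::field set \<Rightarrow> 'a set \<Rightarrow> 'a set" where
  "localization_at A P = {a / b |a b. a \<in> A \<and> b \<in> A - P}"

text \<open>
  For a subring \<open>A\<close> and a set \<open>S\<close> of elements of a field, \<open>proj_with_O1 A S\<close> is
  \<open>Proj A[S]\<close>, where the elements of \<open>S\<close> are given degree one and relations between them
  are the homogeneous ones; it is covered by the charts \<open>Spec A[g/f | g \<in> S]\<close>.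
  Every point \<open>R\<close> (a local ring) is paired with the stalk at \<open>R\<close> of \<open>O(1)\<close>,
  namely the fractional ideal \<open>R f\<close> on the chart \<open>f \<noteq> 0\<close>.
\<close>

definition proj_with_O1 :: "'a::field set \<Rightarrow> 'a set \<Rightarrow> ('a set \<times> 'a set) set" where
  "proj_with_O1 A S =
     {(R, (\<lambda>r. r * f) ` R) |R f P.
        f \<in> S \<and> f \<noteq> 0 \<and> prime_ideal_of (adjoin A ((\<lambda>g. g / f) ` S)) P \<and>
        R = localization_at (adjoin A ((\<lambda>g. g / f) ` S)) P}"

definition zariski :: "'a::field set set \<Rightarrow> 'a set topology" where
  "zariski X = topology_generated_by {{x \<in> X. f \<in> x} |f. True}"

definition max_ideal :: "'a::field set \<Rightarrow> 'a set" where
  "max_ideal x = {f \<in> x. f = 0 \<or> inverse f \<notin> x}"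

definition uniformizer :: "'a::field set \<Rightarrow> 'a \<Rightarrow> bool" where
  "uniformizer x t \<longleftrightarrow> t \<in> x \<and> t \<noteq> 0 \<and> inverse t \<notin> x \<and>
     (\<forall>f. f \<noteq> 0 \<longrightarrow> (\<exists>u n. u \<in> x \<and> inverse u \<in> x \<and> f = u * t powi n))"

definition discrete_valuation_ring :: "'a::field set \<Rightarrow> bool" where
  "discrete_valuation_ring x \<longleftrightarrow> subring_of_field x \<and> (\<exists>t. uniformizer x t)"

definition ord_at :: "'a::field set \<Rightarrow> 'a \<Rightarrow> int" where
  "ord_at x f = (THE n. \<exists>t u. uniformizer x t \<and> u \<in> x \<and> inverse u \<in> x \<and> f = u * t powi n)"

section \<open>Curves\<close>

definition field_embedding :: "('k::field \<Rightarrow> 'K::field) \<Rightarrow> bool" where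
  "field_embedding \<iota> \<longleftrightarrow>
     \<iota> 1 = 1 \<and> (\<forall>a b. \<iota> (a + b) = \<iota> a + \<iota> b) \<and> (\<forall>a b. \<iota> (a * b) = \<iota> a * \<iota> b)"

text \<open>
  Over the perfect field \<open>k\<close>, smooth of dimension one means that the local rings at the
  non-generic points, of which there is at least one, are discrete valuation rings.
  The finite extensions of \<open>k\<close> are the fields \<open>k[T]/(m)\<close> with \<open>m\<close> irreducible, and
  the base change of \<open>X\<close> has generic fibre \<open>Spec K[T]/(m)\<close>. As \<open>m\<close> is separable, that
  base change is irreducible iff \<open>m\<close> is irreducible over \<open>K\<close>.
\<close>

definition smooth_projective_curve ::
  "('k::{field,finite} \<Rightarrow> 'K::field) \<Rightarrow> 'K set set \<Rightarrow> bool" where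
  "smooth_projective_curve \<iota> X \<longleftrightarrow>
     field_embedding \<iota> \<and>
     (\<exists>S. finite S \<and> X = fst ` proj_with_O1 (range \<iota>) S) \<and>
     UNIV \<in> X \<and> X \<noteq> {UNIV} \<and> (\<forall>x \<in> X - {UNIV}. discrete_valuation_ring x)"

definition geometrically_irreducible ::
  "('k::{field,finite} \<Rightarrow> 'K::field) \<Rightarrow> bool" where
  "geometrically_irreducible \<iota> \<longleftrightarrow> (\<forall>m :: 'k poly. irreducible m \<longrightarrow> irreducible (map_poly \<iota> m))"

definition rational_point ::
  "('k::{field,finite} \<Rightarrow> 'K::field) \<Rightarrow> 'K set set \<Rightarrow> 'K set \<Rightarrow> bool" where
  "rational_point \<iota> X x \<longleftrightarrow> x \<in> X \<and> x \<noteq> UNIV \<and> (\<forall>f\<in>x. \<exists>c. f - \<iota> c \<in> max_ideal x)"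

section \<open>Modules and lengths\<close>

definition submodule_over ::
  "'K set \<Rightarrow> ('K \<Rightarrow> 'v \<Rightarrow> 'v) \<Rightarrow> 'v::ab_group_add set \<Rightarrow> bool" where
  "submodule_over A act M \<longleftrightarrow>
     0 \<in> M \<and> (\<forall>u\<in>M. \<forall>v\<in>M. u + v \<in> M) \<and> (\<forall>a\<in>A. \<forall>v\<in>M. act a v \<in> M)"

text \<open>The length of the \<open>A\<close>-module \<open>M/N\<close>, by chains of submodules between \<open>N\<close> and \<open>M\<close>.\<close>

definition quotient_length ::
  "'K set \<Rightarrow> ('K \<Rightarrow> 'v \<Rightarrow> 'v) \<Rightarrow> 'v::ab_group_add set \<Rightarrow> 'v set \<Rightarrow> enat" where
  "quotient_length A act N M =
     Sup {enat n |n. \<exists>C :: nat \<Rightarrow> 'v set. C 0 = N \<and> C n = M \<and>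
            (\<forall>i\<le>n. submodule_over A act (C i)) \<and> (\<forall>i<n. C i \<subset> C (Suc i))}"

text \<open>\<open>[\<kappa>(x) : k]\<close>, the dimension of a vector space being its length.\<close>

definition point_degree ::
  "('k::{field,finite} \<Rightarrow> 'K::field) \<Rightarrow> 'K set \<Rightarrow> nat" where
  "point_degree \<iota> x = the_enat (quotient_length (range \<iota>) (*) (max_ideal x) x)"

section \<open>Vector bundles\<close>

text \<open>
  The sheaf of sections of a vector bundle \<open>V\<close> of rank \<open>n\<close> is a subsheaf of the constant sheaf
  \<open>Rat(V)\<close>, which becomes \<open>K^n\<close> by the choice of a rational frame. A bundle is
  given by the stalks \<open>V x \<subseteq> K^n\<close> of this subsheaf; the sections over an open set
  \<open>U\<close> are the intersection of the \<open>V x\<close>, \<open>x \<in> U\<close>.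
  Homomorphisms of bundles are the \<open>K\<close>-linear maps that respect the stalks.
  Values outside \<open>X\<close> carry no information.
\<close>

type_synonym ('K, 'n) lattice_sheaf = "'K set \<Rightarrow> ('K^'n) set"

definition frame_span :: "'K::field set \<Rightarrow> 'K^'n^'n \<Rightarrow> ('K^'n) set" where
  "frame_span x B = {B *v c |c. \<forall>i. c $ i \<in> x}"

definition vector_bundle :: "'K::field set set \<Rightarrow> ('K, 'n::finite) lattice_sheaf \<Rightarrow> bool" where
  "vector_bundle X V \<longleftrightarrow>
     (\<forall>x\<in>X. \<exists>U B. openin (zariski X) U \<and> x \<in> U \<and> det B \<noteq> 0 \<and> (\<forall>y\<in>U. V y = frame_span y B))"

text \<open>The quotient sheaf \<open>V/N\<close> is locally free: locally, it has a basis given by (the classes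
  of) a finite set \<open>C\<close> of sections of \<open>V\<close>.\<close>

definition locally_free_quotient ::
  "'K::field set set \<Rightarrow> ('K, 'n::finite) lattice_sheaf \<Rightarrow> ('K, 'n) lattice_sheaf \<Rightarrow> bool" where
  "locally_free_quotient X V N \<longleftrightarrow>
     (\<forall>x\<in>X. \<exists>U C. openin (zariski X) U \<and> x \<in> U \<and> finite C \<and>
        (\<forall>y\<in>U. C \<subseteq> V y \<and>
           (\<forall>v\<in>V y. \<exists>!a. a \<in> C \<rightarrow>\<^sub>E y \<and> v - (\<Sum>c\<in>C. a c *s c) \<in> N y)))"

text \<open>The order at \<open>x\<close> of the rational section \<open>e\<^sub>1 \<and> \<dots> \<and> e\<^sub>n\<close> of \<open>det V\<close>, with
  \<open>e\<^sub>i\<close> the standard basis, is \<open>- frame_order x V\<close>.\<close>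

definition frame_order :: "'K::field set \<Rightarrow> ('K, 'n::finite) lattice_sheaf \<Rightarrow> int" where
  "frame_order x V = (THE n. \<exists>B. det B \<noteq> 0 \<and> V x = frame_span x B \<and> n = ord_at x (det B))"

definition bundle_degree ::
  "('k::{field,finite} \<Rightarrow> 'K::field) \<Rightarrow> 'K set set \<Rightarrow> ('K, 'n::finite) lattice_sheaf \<Rightarrow> int" where
  "bundle_degree \<iota> X V =
     - (\<Sum>x \<in> {x \<in> X - {UNIV}. frame_order x V \<noteq> 0}. int (point_degree \<iota> x) * frame_order x V)"

text \<open>\<open>V(D)\<close> for a divisor \<open>D\<close>, given by its multiplicities at the closed points.\<close>

definition twist ::
  "('K::field set \<Rightarrow> int) \<Rightarrow> ('K, 'n::finite) lattice_sheaf \<Rightarrow> ('K, 'n) lattice_sheaf" where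
  "twist D V x =
     (if x = UNIV then V x else {v. \<exists>t. uniformizer x t \<and> (t powi D x) *s v \<in> V x})"

definition point_sum :: "('s::finite \<Rightarrow> 'K set) \<Rightarrow> 'K set \<Rightarrow> int" where
  "point_sum x z = (\<Sum>i\<in>UNIV. if z = x i then 1 else 0)"

text \<open>\<open>Hom(V\<^sub>2, V\<^sub>1)\<close>: its rational sections are matrices, stored with the index type
  \<open>'a \<times> 'b\<close> in order to be a bundle in the above sense.\<close>

definition as_matrix :: "'K^('a::finite \<times> 'b::finite) \<Rightarrow> 'K^'b^'a" where
  "as_matrix h = (\<chi> i j. h $ (i, j))"

definition hom_bundle ::
  "('K::field, 'b::finite) lattice_sheaf \<Rightarrow> ('K, 'a::finite) lattice_sheaf
     \<Rightarrow> ('K, 'a \<times> 'b) lattice_sheaf" where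
  "hom_bundle V2 V1 x = {h. \<forall>v\<in>V2 x. as_matrix h *v v \<in> V1 x}"

text \<open>The kernel \<open>m\<^sub>x V\<^sub>x\<close> of the map from the stalk to the fibre of \<open>V\<close> at a closed point.\<close>

definition fibre_kernel :: "'K::field set \<Rightarrow> ('K, 'n::finite) lattice_sheaf \<Rightarrow> ('K^'n) set" where
  "fibre_kernel x V = {t *s v |t v. t \<in> max_ideal x \<and> v \<in> V x}"

text \<open>The rank of the map of fibres \<open>V\<^sub>2|\<^sub>x \<rightarrow> V\<^sub>1|\<^sub>x\<close> induced by \<open>h \<in> Hom(V\<^sub>2, V\<^sub>1)\<^sub>x\<close>, i.e. the
  dimension of its image.\<close>

definition fibre_rank ::
  "'K::field set \<Rightarrow> ('K, 'b::finite) lattice_sheaf \<Rightarrow> ('K, 'a::finite) lattice_sheaf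
     \<Rightarrow> 'K^('a \<times> 'b) \<Rightarrow> enat" where
  "fibre_rank x V2 V1 h =
     quotient_length x (*s) (fibre_kernel x V1)
       {as_matrix h *v v + w |v w. v \<in> V2 x \<and> w \<in> fibre_kernel x V1}"

section \<open>Cohomology and principal parts\<close>

definition H0 :: "'K::field set set \<Rightarrow> ('K, 'n::finite) lattice_sheaf \<Rightarrow> ('K^'n) set" where
  "H0 X V = (\<Inter>x\<in>X. V x)"

text \<open>
  A principal part in \<open>Prin(V)\<close>, i.e. an element of the direct sum of the \<open>K^n / V x\<close>, is
  given by a family of representatives; families that agree modulo \<open>V x\<close> at every
  \<open>x\<close> represent the same principal part.
\<close>

definition prin_reps :: "'K::field set set \<Rightarrow> ('K, 'n::finite) lattice_sheaf \<Rightarrow> ('K set \<Rightarrow> 'K^'n) set" where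
  "prin_reps X V = {p. finite {x \<in> X. p x \<notin> V x}}"

definition prin_eq ::
  "'K::field set set \<Rightarrow> ('K, 'n::finite) lattice_sheaf \<Rightarrow> ('K set \<Rightarrow> 'K^'n) \<Rightarrow> ('K set \<Rightarrow> 'K^'n) \<Rightarrow> bool" where
  "prin_eq X V p q \<longleftrightarrow> (\<forall>x\<in>X. p x - q x \<in> V x)"

text \<open>\<open>H\<^sup>1(X, V)\<close> as the cokernel of \<open>Rat(V) \<rightarrow> Prin(V)\<close>; \<open>H1_class X V p\<close> is the
  class \<open>[p]\<close>.\<close>

definition H1_class ::
  "'K::field set set \<Rightarrow> ('K, 'n::finite) lattice_sheaf \<Rightarrow> ('K set \<Rightarrow> 'K^'n) \<Rightarrow> ('K set \<Rightarrow> 'K^'n) set" where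
  "H1_class X V p = {q \<in> prin_reps X V. \<exists>f. prin_eq X V q (\<lambda>x. p x + f)}"

definition H1 :: "'K::field set set \<Rightarrow> ('K, 'n::finite) lattice_sheaf \<Rightarrow> ('K set \<Rightarrow> 'K^'n) set set" where
  "H1 X V = H1_class X V ` prin_reps X V"

section \<open>The projective bundle and very ampleness\<close>

text \<open>
  \<open>P(E) = Proj Sym E\<close> lives in the field of rational functions over \<open>K\<close> in variables
  \<open>T\<^sub>0, T\<^sub>1, \<dots>\<close>, of which only those indexed by \<open>to_nat i\<close>, \<open>i\<close> an index of \<open>K^n\<close>, are
  used. An element \<open>v\<close> of \<open>K^n\<close> is a linear form.
\<close>

type_synonym 'K rat_fun = "((nat \<Rightarrow>\<^sub>0 nat) \<Rightarrow>\<^sub>0 'K) fract"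

definition const_fun :: "'K::field \<Rightarrow> 'K rat_fun" where
  "const_fun c = Fract (Poly_Mapping.single 0 c) 1"

definition linear_form :: "'K::field^'n::finite \<Rightarrow> 'K rat_fun" where
  "linear_form v =
     Fract (\<Sum>i\<in>UNIV. Poly_Mapping.single (Poly_Mapping.single (to_nat i) 1) (v $ i)) 1"

definition proj_bundle_with_O1 ::
  "'K::field set set \<Rightarrow> ('K, 'n::finite) lattice_sheaf \<Rightarrow> ('K rat_fun set \<times> 'K rat_fun set) set" where
  "proj_bundle_with_O1 X E = (\<Union>x\<in>X. proj_with_O1 (const_fun ` x) (linear_form ` E x))"

text \<open>
  \<open>O(1)\<close> on \<open>P(E)\<close> is very ample: finitely many of its global sections, which are
  the elements of \<open>H\<^sup>0(X, E)\<close>, define a closed immersion \<open>i\<close> into a projective space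
  with \<open>i\<^sup>* O(1) = O(1)\<close>. The closed integral subscheme of
  projective space with homogeneous coordinate ring \<open>k[S]\<close> is \<open>Proj k[S]\<close>, so that the condition is
  the equality of \<open>P(E)\<close> and \<open>Proj k[S]\<close> together with the respective sheaves \<open>O(1)\<close>.
\<close>

definition O1_very_ample ::
  "('k::{field,finite} \<Rightarrow> 'K::field) \<Rightarrow> 'K set set \<Rightarrow> ('K, 'n::finite) lattice_sheaf \<Rightarrow> bool" where
  "O1_very_ample \<iota> X E \<longleftrightarrow>
     (\<exists>S. finite S \<and> S \<subseteq> linear_form ` H0 X E \<and>
          proj_bundle_with_O1 X E = proj_with_O1 (const_fun ` range \<iota>) S)"

section \<open>The code\<close>

definition word_prin ::
  "('k \<Rightarrow> 'K::field) \<Rightarrow> ('s::finite \<Rightarrow> 'r::finite \<Rightarrow> 'K set \<Rightarrow> 'K^'n::finite) \<Rightarrow> 'k^'r^'s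
     \<Rightarrow> 'K set \<Rightarrow> 'K^'n" where
  "word_prin \<iota> p l z = (\<Sum>i\<in>UNIV. \<Sum>j\<in>UNIV. \<iota> (l $ i $ j) *s p i j z)"

text \<open>The \<open>p i j\<close> form a \<open>k\<close>-basis of the space \<open>H\<^sup>0(X, V(D)/V)\<close> of \<open>V\<close>-valued principal parts that
  are supported on \<open>D\<close> with at most simple poles.\<close>

definition principal_part_basis ::
  "('k \<Rightarrow> 'K::field) \<Rightarrow> 'K set set \<Rightarrow> ('K set \<Rightarrow> int) \<Rightarrow> ('K, 'n::finite) lattice_sheaf
     \<Rightarrow> ('s::finite \<Rightarrow> 'r::finite \<Rightarrow> 'K set \<Rightarrow> 'K^'n) \<Rightarrow> bool" where
  "principal_part_basis \<iota> X D V p \<longleftrightarrow>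
     (\<forall>i j. \<forall>z\<in>X. p i j z \<in> twist D V z) \<and>
     (\<forall>a. (\<forall>z\<in>X. a z \<in> twist D V z) \<longrightarrow> (\<exists>!l :: 'k^'r^'s. prin_eq X V a (word_prin \<iota> p l)))"

definition code ::
  "('k \<Rightarrow> 'K::field) \<Rightarrow> 'K set set \<Rightarrow> ('K set \<Rightarrow> int) \<Rightarrow> ('K, 'n::finite) lattice_sheaf
     \<Rightarrow> ('s::finite \<Rightarrow> 'r::finite \<Rightarrow> 'K set \<Rightarrow> 'K^'n) \<Rightarrow> ('k^'r^'s) set" where
  "code \<iota> X D V p = {l. \<exists>f \<in> H0 X (twist D V). prin_eq X V (\<lambda>_. f) (word_prin \<iota> p l)}"

definition syndrome ::
  "('k \<Rightarrow> 'K::field) \<Rightarrow> 'K set set \<Rightarrow> ('K, 'n::finite) lattice_sheaf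
     \<Rightarrow> ('s::finite \<Rightarrow> 'r::finite \<Rightarrow> 'K set \<Rightarrow> 'K^'n) \<Rightarrow> 'k^'r^'s \<Rightarrow> ('K set \<Rightarrow> 'K^'n) set" where
  "syndrome \<iota> X V p l = H1_class X V (word_prin \<iota> p l)"

definition weight :: "'k::zero^'r::finite^'s::finite \<Rightarrow> nat" where
  "weight l = card {(i, j). l $ i $ j \<noteq> 0}"

section \<open>Extensions, elementary transformations\<close>

definition is_extension ::
  "'K::field set set \<Rightarrow> ('K, 'a::finite) lattice_sheaf \<Rightarrow> ('K, 'm::finite) lattice_sheaf
     \<Rightarrow> ('K, 'b::finite) lattice_sheaf \<Rightarrow> 'K^'a^'m \<Rightarrow> 'K^'m^'b \<Rightarrow> bool" where
  "is_extension X F1 W F2 \<alpha> \<beta> \<longleftrightarrow>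
     vector_bundle X W \<and>
     (\<forall>x\<in>X. inj_on ((*v) \<alpha>) (F1 x) \<and> (*v) \<alpha> ` F1 x = {w \<in> W x. \<beta> *v w = 0} \<and>
            (*v) \<beta> ` W x = F2 x)"

text \<open>
  The class in \<open>H\<^sup>1(X, Hom(F\<^sub>2, F\<^sub>1))\<close> of the extension is the image of the identity under the connecting
  map of \<open>0 \<rightarrow> Hom(F\<^sub>2, F\<^sub>1) \<rightarrow> Hom(F\<^sub>2, W) \<rightarrow> Hom(F\<^sub>2, F\<^sub>2) \<rightarrow> 0\<close>. It is computed
  by the snake lemma from the sequences \<open>0 \<rightarrow> V \<rightarrow> Rat(V) \<rightarrow> Prin(V) \<rightarrow> 0\<close>: lift the identity to
  a rational splitting \<open>\<sigma>\<close>; its principal part comes from one with values in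
  \<open>Hom(F\<^sub>2, F\<^sub>1)\<close>. Like all elements of \<open>H\<^sup>1\<close>, it is a set of families of representatives.
\<close>

definition extension_class ::
  "'K::field set set \<Rightarrow> ('K, 'a::finite) lattice_sheaf \<Rightarrow> ('K, 'm::finite) lattice_sheaf
     \<Rightarrow> ('K, 'b::finite) lattice_sheaf \<Rightarrow> 'K^'a^'m \<Rightarrow> 'K^'m^'b \<Rightarrow> ('K set \<Rightarrow> 'K^('a \<times> 'b)) set" where
  "extension_class X F1 W F2 \<alpha> \<beta> =
     {a \<in> prin_reps X (hom_bundle F2 F1).
        \<exists>\<sigma> :: 'K^'b^'m. \<beta> ** \<sigma> = mat 1 \<and>
          (\<forall>x\<in>X. \<forall>v\<in>F2 x. \<sigma> *v v - \<alpha> *v (as_matrix (a x) *v v) \<in> W x)}"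

text \<open>Elementary transformations of \<open>F\<close> have full rank, hence the same rational sections.\<close>

definition elementary_transformation ::
  "'K::field set set \<Rightarrow> ('K, 'n::finite) lattice_sheaf \<Rightarrow> ('K, 'n) lattice_sheaf \<Rightarrow> bool" where
  "elementary_transformation X G F \<longleftrightarrow> vector_bundle X G \<and> (\<forall>x\<in>X. G x \<subseteq> F x)"

definition lifts_to_subbundle ::
  "'K::field set set \<Rightarrow> ('K, 'b::finite) lattice_sheaf \<Rightarrow> ('K, 'm::finite) lattice_sheaf
     \<Rightarrow> 'K^'m^'b \<Rightarrow> bool" where
  "lifts_to_subbundle X G W \<beta> \<longleftrightarrow>
     (\<exists>\<phi> :: 'K^'b^'m.
        (\<forall>x\<in>X. \<forall>v\<in>G x. \<phi> *v v \<in> W x \<and> \<beta> *v (\<phi> *v v) = v) \<and>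
        locally_free_quotient X W (\<lambda>x. (*v) \<phi> ` G x))"

text \<open>A subsheaf \<open>\<tau>\<close> of \<open>Prin(V)\<close> contained in \<open>V(D)/V\<close>, given by its preimage \<open>T\<close> in
  \<open>Rat(V)\<close>: the stalk of \<open>\<tau>\<close> at \<open>x\<close> is \<open>T x / V x\<close>. Subsheaves of a skyscraper
  sheaf are given by arbitrary submodules of its stalks.\<close>

definition simple_pole_subsheaf ::
  "'K::field set set \<Rightarrow> ('K set \<Rightarrow> int) \<Rightarrow> ('K, 'n::finite) lattice_sheaf
     \<Rightarrow> ('K, 'n) lattice_sheaf \<Rightarrow> bool" where
  "simple_pole_subsheaf X D V T \<longleftrightarrow>
     (\<forall>x\<in>X. submodule_over x (*s) (T x) \<and> V x \<subseteq> T x \<and> T x \<subseteq> twist D V x)"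

definition skyscraper_length ::
  "'K::field set set \<Rightarrow> ('K, 'n::finite) lattice_sheaf \<Rightarrow> ('K, 'n) lattice_sheaf \<Rightarrow> enat" where
  "skyscraper_length X V T =
     (\<Sum>x \<in> {x \<in> X. T x \<noteq> V x}. quotient_length x (*s) (V x) (T x))"

text \<open>
  \<open>0 \<rightarrow> G \<rightarrow> F \<rightarrow> \<tau> \<rightarrow> 0\<close> is exact, with \<open>\<tau>\<close> given by \<open>T\<close> as above. The homomorphism \<open>F \<rightarrow> \<tau>\<close>
  is given by its maps of stalks, and \<open>q x v\<close> represents the image of \<open>v\<close> in
  \<open>T x / V x\<close>; a homomorphism to a skyscraper sheaf is an arbitrary family of homomorphisms
  of stalks.
\<close>

definition skyscraper_quotient_sequence ::
  "'K::field set set \<Rightarrow> ('K, 'b::finite) lattice_sheaf \<Rightarrow> ('K, 'b) lattice_sheaf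
     \<Rightarrow> ('K, 'a::finite) lattice_sheaf \<Rightarrow> ('K, 'a) lattice_sheaf \<Rightarrow> bool" where
  "skyscraper_quotient_sequence X G F V T \<longleftrightarrow>
     (\<exists>q :: 'K set \<Rightarrow> 'K^'b \<Rightarrow> 'K^'a. \<forall>x\<in>X.
        (\<forall>u\<in>F x. \<forall>v\<in>F x. q x (u + v) - (q x u + q x v) \<in> V x) \<and>
        (\<forall>c\<in>x. \<forall>v\<in>F x. q x (c *s v) - c *s q x v \<in> V x) \<and>
        {v \<in> F x. q x v \<in> V x} = G x \<and>
        {q x v + w |v w. v \<in> F x \<and> w \<in> V x} = T x)"

end

theory Submission
  imports Defs
begin

text \<open>
  The error word \<open>e\<close> has the same syndrome as \<open>y\<close>, because the principal part of a codeword comes from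
  a rational section of \<open>Hom(F\<^sub>2, F\<^sub>1)\<close> and so vanishes in \<open>H\<^sup>1\<close>. Therefore the principal part
  \<open>a\<close> of \<open>e\<close> is a representative of the class of the extension: there is a rational splitting \<open>\<sigma>\<close> of
  \<open>\<beta>\<close> such that \<open>\<sigma> v - \<alpha> (a v)\<close> is regular in \<open>W\<close> for all regular \<open>v\<close> in \<open>F\<^sub>2\<close>. Consequently
  \<open>\<sigma> v\<close> is regular exactly for \<open>v\<close> in \<open>G\<close>, the subsheaf of \<open>F\<^sub>2\<close> of those \<open>v\<close> with \<open>a v\<close> regular in
  \<open>F\<^sub>1\<close>. In other words, \<open>G\<close> is the kernel of \<open>v \<mapsto> a v\<close> from \<open>F\<^sub>2\<close> to \<open>Prin(F\<^sub>1)\<close>, its image is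
  \<open>\<tau> = T/F\<^sub>1\<close> with \<open>T = F\<^sub>1 + a F\<^sub>2\<close>, and \<open>\<sigma>\<close> lifts \<open>G\<close> to \<open>W\<close>.

  The image \<open>\<sigma> G = W \<inter> \<sigma> Rat(F\<^sub>2)\<close> is saturated, and the projection along \<open>\<sigma>\<close> onto \<open>Rat(F\<^sub>1)\<close> identifies
  the quotient of \<open>W\<close> by it with \<open>T\<close>. So the lift of \<open>G\<close> is a subbundle as soon as \<open>T\<close> is a bundle
  (\<open>saturated_quotient_locally_free\<close>).

  That \<open>G\<close> and \<open>T\<close> are bundles is a question about finitely many points, as they agree with \<open>F\<^sub>2\<close> and
  \<open>F\<^sub>1\<close> away from the support of \<open>D\<close>. Over a discrete valuation ring every module between two lattices
  is a lattice (\<open>lattice_between\<close>), by choosing a frame inside it whose determinant has the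
  smallest order. A change of finitely many stalks by other lattices gives again a bundle
  (\<open>vector_bundle_modify\<close>); the change of frame at a point \<open>x\<close> spreads to a neighbourhood because every
  rational function is regular on some punctured neighbourhood of \<open>x\<close>. At a rational point this
  has an elementary proof: if the affine ring of a chart is \<open>k[c\<^sub>1, ..., c\<^sub>m]\<close>, then the
  maximal ideal of \<open>x\<close> is generated by the \<open>c\<^sub>i - c\<^sub>i(x)\<close>, so it suffices to clear the denominators of finitely many
  functions (\<open>regular_near_rational_point\<close>).

  The two numerical bounds are local as well. At \<open>x\<^sub>i\<close> the principal part \<open>a\<close> is, up to regular terms, a sum of as many
  principal parts with a simple pole along a line as \<open>e\<close> has nonzero entries at \<open>x\<^sub>i\<close>. Each of them
  enlarges \<open>F\<^sub>1\<close>, or diminishes \<open>F\<^sub>2\<close>, by a module of length at most one, that is, it changes the order of the determinant of a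
  frame by at most one (\<open>lattice_containing_poles\<close>, \<open>lattice_avoiding_poles\<close>). The sum over
  all \<open>i\<close> is the weight of \<open>e\<close>.
\<close>

section \<open>Subrings of a field and discrete valuation rings\<close>

lemma
  assumes "subring_of_field A"
  shows subring_one: "1 \<in> A"
    and subring_zero: "0 \<in> A"
    and subring_diff: "a \<in> A \<Longrightarrow> b \<in> A \<Longrightarrow> a - b \<in> A"
    and subring_mult: "a \<in> A \<Longrightarrow> b \<in> A \<Longrightarrow> a * b \<in> A"
    and subring_uminus: "a \<in> A \<Longrightarrow> - a \<in> A"
    and subring_add: "a \<in> A \<Longrightarrow> b \<in> A \<Longrightarrow> a + b \<in> A"
proof -
  show one: "1 \<in> A"
    using assms by (simp add: subring_of_field_def)
  show diff: "a - b \<in> A" if "a \<in> A" "b \<in> A" for a b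
    using assms that by (auto simp: subring_of_field_def)
  show zero: "0 \<in> A"
    using diff[OF one one] by simp
  show "a * b \<in> A" if "a \<in> A" "b \<in> A"
    using assms that by (auto simp: subring_of_field_def)
  show uminus: "- a \<in> A" if "a \<in> A" for a
    using diff[OF zero that] by simp
  show "a + b \<in> A" if "a \<in> A" "b \<in> A"
    using diff[OF that(1) uminus[OF that(2)]] by simp
qed

lemma subring_power: "subring_of_field A \<Longrightarrow> a \<in> A \<Longrightarrow> a ^ n \<in> A"
  by (induction n) (auto intro: subring_one subring_mult)

lemma subring_sum: "subring_of_field A \<Longrightarrow> (\<And>i. i \<in> I \<Longrightarrow> f i \<in> A) \<Longrightarrow> (\<Sum>i\<in>I. f i) \<in> A"
  by (induction I rule: infinite_finite_induct) (auto intro: subring_zero subring_add)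

lemma subring_prod: "subring_of_field A \<Longrightarrow> (\<And>i. i \<in> I \<Longrightarrow> f i \<in> A) \<Longrightarrow> (\<Prod>i\<in>I. f i) \<in> A"
  by (induction I rule: infinite_finite_induct) (auto intro: subring_one subring_mult)

lemma subring_det:
  assumes "subring_of_field A" "\<And>i j. M $ i $ j \<in> A"
  shows "det M \<in> A"
proof -
  have "of_int (sign q) \<in> A" for q :: "'n \<Rightarrow> 'n"
    using subring_one[OF assms(1)] subring_uminus[OF assms(1) subring_one[OF assms(1)]]
    by (auto simp: sign_def)
  then show ?thesis
    unfolding det_def
    by (intro subring_sum subring_mult subring_prod assms) auto
qed

lemma subring_UNIV: "subring_of_field UNIV"
  by (simp add: subring_of_field_def)

lemma dvr_subring: "discrete_valuation_ring A \<Longrightarrow> subring_of_field A"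
  by (simp add: discrete_valuation_ring_def)

lemma uniformizer_nonzero: "uniformizer A t \<Longrightarrow> t \<noteq> 0"
  by (simp add: uniformizer_def)

lemma uniformizer_decomposition:
  assumes "uniformizer A t" "f \<noteq> 0"
  obtains u n where "u \<in> A" "inverse u \<in> A" "u \<noteq> 0" "f = u * t powi n"
  using assms unfolding uniformizer_def by (metis mult_zero_left)

lemma uniformizer_powi_mem_iff:
  assumes A: "subring_of_field A" and t: "uniformizer A t"
  shows "t powi n \<in> A \<longleftrightarrow> 0 \<le> n"
proof
  assume n: "t powi n \<in> A"
  show "0 \<le> n"
  proof (rule ccontr)
    assume "\<not> 0 \<le> n"
    then have "t powi n * t ^ nat (- n - 1) = inverse t"
      using uniformizer_nonzero[OF t]
      by (simp add: power_int_add[symmetric] power_int_nonneg_exp[symmetric] power_int_minus)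
    then have "inverse t \<in> A"
      using subring_mult[OF A n subring_power[OF A, of t]] t by (metis uniformizer_def)
    then show False
      using t by (simp add: uniformizer_def)
  qed
next
  assume "0 \<le> n"
  then show "t powi n \<in> A"
    using A t by (simp add: power_int_nonneg_exp subring_power uniformizer_def)
qed

lemma unit_powi_mem:
  assumes "subring_of_field A" "u \<in> A" "inverse u \<in> A"
  shows "u powi n \<in> A"
  using assms by (cases "0 \<le> n") (auto simp: power_int_def intro: subring_power)

lemma unit_times_powi_mem_iff:
  assumes A: "subring_of_field A" and t: "uniformizer A t"
    and u: "u \<in> A" "inverse u \<in> A" "u \<noteq> 0"
  shows "u * t powi n \<in> A \<longleftrightarrow> 0 \<le> n"
proof -
  have "u * t powi n \<in> A \<longleftrightarrow> t powi n \<in> A"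
  proof
    assume "u * t powi n \<in> A"
    from subring_mult[OF A u(2) this] u(3) show "t powi n \<in> A"
      by (simp add: mult.assoc[symmetric])
  qed (use subring_mult[OF A u(1)] in auto)
  then show ?thesis
    using uniformizer_powi_mem_iff[OF A t] by simp
qed

text \<open>
  Write \<open>t' = w t\<^sup>n\<close> and \<open>t = v t'\<^sup>m\<close> with units \<open>v, w\<close>. Both exponents are positive, and
  \<open>n m = 1\<close> because a power of \<open>t\<close> is a unit only if its exponent is zero.
\<close>

lemma uniformizers_associated:
  assumes A: "subring_of_field A" and t: "uniformizer A t" and t': "uniformizer A t'"
  obtains w where "w \<in> A" "inverse w \<in> A" "w \<noteq> 0" "t' = w * t"
proof -
  obtain w n where w: "w \<in> A" "inverse w \<in> A" "w \<noteq> 0" "t' = w * t powi n"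
    using uniformizer_decomposition[OF t uniformizer_nonzero[OF t']] .
  obtain v m where v: "v \<in> A" "inverse v \<in> A" "v \<noteq> 0" "t = v * t' powi m"
    using uniformizer_decomposition[OF t' uniformizer_nonzero[OF t]] .
  have pos: "0 < k" if "u \<in> A" "inverse u \<in> A" "u \<noteq> 0" "s' = u * s powi k"
    "uniformizer A s" "uniformizer A s'" for u s s' k
  proof -
    have "0 \<le> k"
      using that unit_times_powi_mem_iff[OF A that(5), of u k] by (auto simp: uniformizer_def)
    moreover have "k \<noteq> 0"
      using that by (auto simp: uniformizer_def)
    ultimately show ?thesis
      by simp
  qed
  have n: "0 < n" and m: "0 < m"
    using pos[OF w t t'] pos[OF v t' t] by auto
  have "v * (w powi m * t powi (n * m)) = t"
    by (metis v(4) w(4) power_int_mult power_int_mult_distrib)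
  define z where "z = v * w powi m"
  have z: "z \<in> A" "inverse z \<in> A" "z \<noteq> 0"
    using unit_powi_mem[OF A] w v A by (auto simp: z_def power_int_inverse[symmetric] intro!: subring_mult)
  have "z * t powi (n * m - 1) = 1"
    using \<open>v * (w powi m * t powi (n * m)) = t\<close> uniformizer_nonzero[OF t]
    by (simp add: z_def power_int_diff field_simps)
  then have "inverse z * t powi (1 - n * m) = 1"
    using z(3) uniformizer_nonzero[OF t] by (simp add: power_int_diff field_simps)
  then have "0 \<le> 1 - n * m"
    using unit_times_powi_mem_iff[OF A t, of "inverse z" "1 - n * m"] z subring_one[OF A] by simp
  moreover have "n * 1 \<le> n * m"
    using n m by (intro mult_left_mono) auto
  ultimately have "n = 1"
    using n by linarith
  with w that show thesis
    by simp
qed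

text \<open>
  The definite description in the definition of the order does not depend on the uniformizer, as any two of
  them differ by a unit.
\<close>

lemma ord_at_unique:
  assumes A: "subring_of_field A" and t: "uniformizer A t"
    and u: "u \<in> A" "inverse u \<in> A" "u \<noteq> 0"
  shows "ord_at A (u * t powi n) = n"
  unfolding ord_at_def
proof (rule the_equality)
  fix m
  assume "\<exists>t' u'. uniformizer A t' \<and> u' \<in> A \<and> inverse u' \<in> A \<and> u * t powi n = u' * t' powi m"
  then obtain t' u' where t': "uniformizer A t'" and u': "u' \<in> A" "inverse u' \<in> A"
    and eq: "u * t powi n = u' * t' powi m"
    by blast
  obtain w where w: "w \<in> A" "inverse w \<in> A" "w \<noteq> 0" "t' = w * t"
    using uniformizers_associated[OF A t t'] .
  have nz: "u' \<noteq> 0" "t \<noteq> 0"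
    using eq u(3) uniformizer_nonzero[OF t] by auto
  define z where "z = u' * w powi m * inverse u"
  have z: "z \<in> A" "inverse z \<in> A" "z \<noteq> 0"
    using u u' w nz unit_powi_mem[OF A] A
    by (auto simp: z_def power_int_inverse[symmetric] intro!: subring_mult)
  have "u * t powi n = u * (z * t powi m)"
    using eq u(3) by (simp add: z_def w(4) power_int_mult_distrib field_simps)
  then have "t powi n = z * t powi m"
    using u(3) by simp
  then have "z * t powi (m - n) = 1"
    using nz z(3) by (simp add: power_int_diff field_simps)
  moreover from this have "inverse z * t powi (n - m) = 1"
    using nz z by (simp add: power_int_diff field_simps)
  ultimately have "0 \<le> m - n" "0 \<le> n - m"
    using unit_times_powi_mem_iff[OF A t] z subring_one[OF A] by (metis inverse_inverse_eq inverse_zero_imp_zero)+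
  then show "m = n"
    by simp
qed (use assms in blast)

lemma ord_at_uniformizer: "subring_of_field A \<Longrightarrow> uniformizer A t \<Longrightarrow> ord_at A t = 1"
  using ord_at_unique[of A t 1 1] by (simp add: subring_one)

lemma ord_at_mult:
  assumes "discrete_valuation_ring A" "f \<noteq> 0" "g \<noteq> 0"
  shows "ord_at A (f * g) = ord_at A f + ord_at A g"
proof -
  from assms(1) obtain t where A: "subring_of_field A" and t: "uniformizer A t"
    by (auto simp: discrete_valuation_ring_def)
  obtain u n where u: "u \<in> A" "inverse u \<in> A" "u \<noteq> 0" "f = u * t powi n"
    using uniformizer_decomposition[OF t assms(2)] .
  obtain v m where v: "v \<in> A" "inverse v \<in> A" "v \<noteq> 0" "g = v * t powi m"
    using uniformizer_decomposition[OF t assms(3)] .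
  have "f * g = (u * v) * t powi (n + m)"
    using uniformizer_nonzero[OF t] u v by (simp add: power_int_add)
  moreover have "u * v \<in> A" "inverse (u * v) \<in> A" "u * v \<noteq> 0"
    using u v A by (auto intro: subring_mult)
  ultimately show ?thesis
    using u v by (metis ord_at_unique[OF A t])
qed

lemma mem_dvr_iff_ord:
  assumes "discrete_valuation_ring A" "f \<noteq> 0"
  shows "f \<in> A \<longleftrightarrow> 0 \<le> ord_at A f"
proof -
  from assms(1) obtain t where A: "subring_of_field A" and t: "uniformizer A t"
    by (auto simp: discrete_valuation_ring_def)
  obtain u n where u: "u \<in> A" "inverse u \<in> A" "u \<noteq> 0" "f = u * t powi n"
    using uniformizer_decomposition[OF t assms(2)] .
  then show ?thesis
    using ord_at_unique[OF A t] unit_times_powi_mem_iff[OF A t] by metis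
qed

lemma ord_at_inverse:
  assumes "discrete_valuation_ring A" "f \<noteq> 0"
  shows "ord_at A (inverse f) = - ord_at A f"
proof -
  have "ord_at A 1 + ord_at A 1 = ord_at A 1"
    using ord_at_mult[OF assms(1), of 1 1] by simp
  moreover have "ord_at A f + ord_at A (inverse f) = ord_at A 1"
    using ord_at_mult[OF assms(1,2), of "inverse f"] assms(2) by simp
  ultimately show ?thesis
    by simp
qed

lemma ord_at_divide:
  assumes "discrete_valuation_ring A" "f \<noteq> 0" "g \<noteq> 0"
  shows "ord_at A (f / g) = ord_at A f - ord_at A g"
  using assms by (simp add: divide_inverse ord_at_mult ord_at_inverse)

lemma mem_max_ideal_iff_ord:
  assumes "discrete_valuation_ring A" "f \<noteq> 0"
  shows "f \<in> max_ideal A \<longleftrightarrow> 0 < ord_at A f"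
  using assms mem_dvr_iff_ord[of A f] mem_dvr_iff_ord[of A "inverse f"]
  by (auto simp: max_ideal_def ord_at_inverse)

lemma mem_max_ideal_iff:
  assumes A: "discrete_valuation_ring A" and t: "uniformizer A t"
  shows "f \<in> max_ideal A \<longleftrightarrow> f / t \<in> A"
proof (cases "f = 0")
  case False
  then show ?thesis
    using uniformizer_nonzero[OF t] A ord_at_uniformizer[OF dvr_subring[OF A] t]
    by (auto simp: mem_max_ideal_iff_ord mem_dvr_iff_ord ord_at_divide)
qed (use dvr_subring[OF A] in \<open>auto simp: max_ideal_def subring_zero\<close>)

lemma
  assumes A: "discrete_valuation_ring A"
  shows max_ideal_add: "f \<in> max_ideal A \<Longrightarrow> g \<in> max_ideal A \<Longrightarrow> f + g \<in> max_ideal A"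
    and max_ideal_mult: "r \<in> A \<Longrightarrow> g \<in> max_ideal A \<Longrightarrow> r * g \<in> max_ideal A"
proof -
  obtain t where t: "uniformizer A t"
    using A by (auto simp: discrete_valuation_ring_def)
  show "f + g \<in> max_ideal A" if "f \<in> max_ideal A" "g \<in> max_ideal A"
    using that subring_add[OF dvr_subring[OF A]]
    by (simp add: mem_max_ideal_iff[OF A t] add_divide_distrib)
  show "r * g \<in> max_ideal A" if "r \<in> A" "g \<in> max_ideal A"
    using that subring_mult[OF dvr_subring[OF A]]
    by (simp add: mem_max_ideal_iff[OF A t] times_divide_eq_right[symmetric] del: times_divide_eq_right)
qed

lemma uniformizer_in_max_ideal: "uniformizer A t \<Longrightarrow> t \<in> max_ideal A"
  by (auto simp: uniformizer_def max_ideal_def)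

lemma max_ideal_subset: "max_ideal A \<subseteq> A"
  by (auto simp: max_ideal_def)

lemma max_ideal_zero: "discrete_valuation_ring A \<Longrightarrow> 0 \<in> max_ideal A"
  using subring_zero[OF dvr_subring] by (auto simp: max_ideal_def)

text \<open>
  An element outside \<open>A\<close> has negative order, so a ring that contains it and \<open>A\<close> contains the inverse of a
  uniformizer. For points of a curve this says that no closed point specializes to another one.
\<close>

lemma dvr_maximal_subring:
  assumes A: "discrete_valuation_ring A" and B: "subring_of_field B" and "A \<subseteq> B"
  shows "B = A \<or> B = UNIV"
proof (rule disjCI)
  assume "B \<noteq> UNIV"
  from A obtain t where t: "uniformizer A t"
    by (auto simp: discrete_valuation_ring_def)
  have tB: "t \<in> B"
    using t \<open>A \<subseteq> B\<close> by (auto simp: uniformizer_def)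
  show "B = A"
  proof (rule ccontr)
    assume "B \<noteq> A"
    then obtain f where f: "f \<in> B" "f \<notin> A"
      using \<open>A \<subseteq> B\<close> by auto
    then have "f \<noteq> 0"
      using subring_zero[OF dvr_subring[OF A]] by auto
    then obtain u n where u: "u \<in> A" "inverse u \<in> A" "u \<noteq> 0" "f = u * t powi n"
      by (rule uniformizer_decomposition[OF t])
    have n: "n < 0"
      using unit_times_powi_mem_iff[OF dvr_subring[OF A] t u(1-3)] f u(4) by (metis not_le)
    have "inverse t = inverse u * (f * t ^ nat (- n - 1))"
      using n u(3) uniformizer_nonzero[OF t]
      by (simp add: u(4) power_int_nonneg_exp[symmetric] power_int_add[symmetric] power_int_minus
          mult.assoc)
    then have it: "inverse t \<in> B"
      using f u tB \<open>A \<subseteq> B\<close> by (auto intro!: subring_mult[OF B] subring_power[OF B])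
    have "g \<in> B" for g
    proof (cases "g = 0")
      case False
      then obtain v m where v: "v \<in> A" "g = v * t powi m"
        using uniformizer_decomposition[OF t] by metis
      then show ?thesis
        using unit_powi_mem[OF B tB it] \<open>A \<subseteq> B\<close> by (auto intro: subring_mult[OF B])
    qed (use subring_zero[OF B] in simp)
    then show False
      using \<open>B \<noteq> UNIV\<close> by auto
  qed
qed

section \<open>Submodules and lattices in a vector space of columns\<close>

lemma
  assumes "submodule_over A act M"
  shows submodule_zero: "0 \<in> M"
    and submodule_add: "u \<in> M \<Longrightarrow> v \<in> M \<Longrightarrow> u + v \<in> M"
    and submodule_scale: "a \<in> A \<Longrightarrow> v \<in> M \<Longrightarrow> act a v \<in> M"
  using assms by (auto simp: submodule_over_def)

lemma submodule_diff:
  assumes "subring_of_field A" "submodule_over A (*s) M" "u \<in> M" "v \<in> M"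
  shows "u - v \<in> M"
proof -
  have "u + (-1) *s v \<in> M"
    using assms by (intro submodule_add[OF assms(2)] submodule_scale[OF assms(2)])
      (auto intro: subring_one subring_uminus)
  then show ?thesis
    by (simp add: vector_sneg_minus1[symmetric])
qed

lemma submodule_sum: "submodule_over A act M \<Longrightarrow> (\<And>i. i \<in> I \<Longrightarrow> f i \<in> M) \<Longrightarrow> (\<Sum>i\<in>I. f i) \<in> M"
  by (induction I rule: infinite_finite_induct) (auto intro: submodule_zero submodule_add)

lemma matrix_vector_scale: "(M :: 'K::field^'n^'m) *v (c *s v) = c *s (M *v v)"
  by (simp add: vec.scale)

lemma submodule_frame_span:
  assumes "subring_of_field A"
  shows "submodule_over A (*s) (frame_span A B)"
  unfolding submodule_over_def frame_span_def
proof (intro conjI ballI)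
  show "0 \<in> {B *v c |c. \<forall>i. c $ i \<in> A}"
    using subring_zero[OF assms] by (auto intro!: exI[of _ 0])
next
  fix u v assume "u \<in> {B *v c |c. \<forall>i. c $ i \<in> A}" "v \<in> {B *v c |c. \<forall>i. c $ i \<in> A}"
  then obtain c d where "u = B *v c" "v = B *v d" "\<forall>i. c $ i \<in> A" "\<forall>i. d $ i \<in> A"
    by auto
  then show "u + v \<in> {B *v c |c. \<forall>i. c $ i \<in> A}"
    using subring_add[OF assms]
    by (auto simp: matrix_vector_right_distrib[symmetric] intro!: exI[of _ "c + d"])
next
  fix a v assume "a \<in> A" "v \<in> {B *v c |c. \<forall>i. c $ i \<in> A}"
  then obtain d where "v = B *v d" "\<forall>i. d $ i \<in> A"
    by auto
  then show "a *s v \<in> {B *v c |c. \<forall>i. c $ i \<in> A}"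
    using subring_mult[OF assms \<open>a \<in> A\<close>]
    by (auto simp: matrix_vector_scale intro!: exI[of _ "a *s d"])
qed

lemma matrix_vector_axis: "B *v axis j 1 = column j (B :: 'K::field^'n::finite^'m)"
  by (simp add: vec_eq_iff matrix_vector_mult_def axis_def column_def if_distrib cong: if_cong)

lemma column_in_frame_span:
  assumes "subring_of_field A"
  shows "column j B \<in> frame_span A B"
  using subring_one[OF assms] subring_zero[OF assms] matrix_vector_axis[of B j]
  unfolding frame_span_def by (auto simp: axis_def intro!: exI[of _ "axis j 1"])

lemma frame_span_subset_iff:
  assumes "subring_of_field A" "submodule_over A (*s) M"
  shows "frame_span A B \<subseteq> M \<longleftrightarrow> (\<forall>j. column j B \<in> M)"
proof
  assume columns: "\<forall>j. column j B \<in> M"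
  show "frame_span A B \<subseteq> M"
    unfolding frame_span_def
    using columns by (auto simp: matrix_mult_sum intro!: submodule_sum[OF assms(2)] submodule_scale[OF assms(2)])
qed (use column_in_frame_span[OF assms(1)] in blast)

lemma frame_inverse:
  assumes "det (B :: 'K::field^'n^'n) \<noteq> 0"
  obtains B' where "B' ** B = mat 1" "B ** B' = mat 1" "det B' \<noteq> 0"
proof -
  obtain B' where B': "B ** B' = mat 1" "B' ** B = mat 1"
    using assms by (auto simp: invertible_det_nz[symmetric] invertible_def)
  then have "det B * det B' = 1"
    by (metis det_mul det_I)
  then have "det B' \<noteq> 0"
    by auto
  with B' that show thesis
    by blast
qed

lemma frame_span_mult_subset:
  assumes "subring_of_field A" "\<And>i j. P $ i $ j \<in> A"
  shows "frame_span A (B ** P) \<subseteq> frame_span A B"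
proof
  fix v assume "v \<in> frame_span A (B ** P)"
  then obtain c where c: "v = B *v (P *v c)" "\<forall>i. c $ i \<in> A"
    by (auto simp: frame_span_def matrix_vector_mul_assoc)
  have "(P *v c) $ i \<in> A" for i
    using assms c by (auto simp: matrix_vector_mult_def intro!: subring_sum subring_mult)
  then show "v \<in> frame_span A B"
    using c by (auto simp: frame_span_def)
qed

lemma frame_span_UNIV:
  assumes "det (B :: 'K::field^'n^'n) \<noteq> 0"
  shows "frame_span UNIV B = UNIV"
proof -
  obtain B' where "B ** B' = mat 1"
    using frame_inverse[OF assms] .
  then have "v = B *v (B' *v v)" for v
    by (simp add: matrix_vector_mul_assoc)
  then show ?thesis
    by (fastforce simp: frame_span_def)
qed

definition lattice_at :: "'K::field set \<Rightarrow> ('K^'n::finite) set \<Rightarrow> bool" where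
  "lattice_at A M \<longleftrightarrow> (\<exists>B. det B \<noteq> 0 \<and> M = frame_span A B)"

lemma lattice_submodule: "subring_of_field A \<Longrightarrow> lattice_at A M \<Longrightarrow> submodule_over A (*s) M"
  by (auto simp: lattice_at_def submodule_frame_span)

text \<open>
  The transition matrix from the smaller to the larger lattice has entries, hence determinant, in \<open>A\<close>.
\<close>

lemma ord_det_mono:
  assumes A: "discrete_valuation_ring A" and nz: "det B \<noteq> 0" "det B' \<noteq> 0"
    and sub: "frame_span A B \<subseteq> frame_span A B'"
  shows "ord_at A (det B') \<le> ord_at A (det B)"
proof -
  note R = dvr_subring[OF A]
  have "\<exists>c. column j B = B' *v c \<and> (\<forall>i. c $ i \<in> A)" for j
    using column_in_frame_span[OF R, of j B] sub by (auto simp: frame_span_def)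
  then obtain c where c: "\<And>j. column j B = B' *v c j" "\<And>i j. c j $ i \<in> A"
    by metis
  define P where "P = (\<chi> i j. c j $ i)"
  have "B = B' ** P"
    using c(1) by (simp add: P_def vec_eq_iff matrix_matrix_mult_def matrix_vector_mult_def column_def)
  then have "det B = det B' * det P"
    by (simp add: det_mul)
  moreover have "det P \<in> A"
    using c(2) by (intro subring_det R) (simp add: P_def)
  ultimately show ?thesis
    using nz A by (auto simp: ord_at_mult mem_dvr_iff_ord)
qed

text \<open>
  The order of the determinant of any frame. It only depends on the stalk, and it drops when
  the lattice grows; the degree of a bundle is minus the sum of these numbers, weighted by the degrees of the points.
\<close>

definition lattice_order :: "'K::field set \<Rightarrow> ('K^'n::finite) set \<Rightarrow> int" where
  "lattice_order A M = frame_order A (\<lambda>_. M)"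

lemma frame_order_lattice_order: "frame_order x V = lattice_order x (V x)"
  by (simp add: frame_order_def lattice_order_def)

lemma lattice_order_frame_span:
  assumes "discrete_valuation_ring A" "det B \<noteq> 0"
  shows "lattice_order A (frame_span A B) = ord_at A (det B)"
  unfolding lattice_order_def frame_order_def
proof (rule the_equality)
  fix n assume "\<exists>B'. det B' \<noteq> 0 \<and> frame_span A B = frame_span A B' \<and> n = ord_at A (det B')"
  then show "n = ord_at A (det B)"
    using assms by (auto intro!: antisym ord_det_mono)
qed (use assms in blast)

lemma lattice_order_mono:
  assumes "discrete_valuation_ring A" "lattice_at A N" "lattice_at A M" "N \<subseteq> M"
  shows "lattice_order A M \<le> lattice_order A N"
  using assms ord_det_mono by (fastforce simp: lattice_at_def lattice_order_frame_span)

definition replace_column :: "'n \<Rightarrow> 'K^'n \<Rightarrow> 'K^'n^'n \<Rightarrow> 'K^'n^'n::finite" where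
  "replace_column k v B = (\<chi> i j. if j = k then v $ i else B $ i $ j)"

lemma column_replace_column: "column j (replace_column k v B) = (if j = k then v else column j B)"
  by (simp add: replace_column_def column_def vec_eq_iff)

lemma det_replace_column: "det (replace_column k (B *v c) B) = c $ k * det (B :: 'K::field^'n^'n)"
  unfolding replace_column_def by (rule cramer_lemma)

lemma frame_coordinates:
  assumes "det (B :: 'K::field^'n^'n) \<noteq> 0"
  obtains c where "v = B *v c"
  using frame_span_UNIV[OF assms] by (auto simp: frame_span_def set_eq_iff)

text \<open>
  A vector of \<open>M\<close> that is not in the span of \<open>B\<close> has a coordinate with respect to \<open>B\<close> of negative order. When
  it replaces the corresponding column, Cramer's rule multiplies the determinant by that coordinate.
\<close>

lemma frame_enlarge:
  assumes A: "discrete_valuation_ring A" and M: "submodule_over A (*s) M"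
    and B: "det B \<noteq> 0" "frame_span A B \<subset> M"
  obtains B' where "det B' \<noteq> 0" "frame_span A B' \<subseteq> M" "ord_at A (det B') < ord_at A (det B)"
proof -
  note R = dvr_subring[OF A]
  obtain v where v: "v \<in> M" "v \<notin> frame_span A B"
    using B by auto
  obtain c where c: "v = B *v c"
    using frame_coordinates[OF B(1)] .
  then obtain k where k: "c $ k \<notin> A"
    using v by (auto simp: frame_span_def)
  then have nz: "c $ k \<noteq> 0"
    using subring_zero[OF R] by auto
  let ?B = "replace_column k v B"
  have det: "det ?B = c $ k * det B"
    by (simp add: c det_replace_column)
  have "frame_span A ?B \<subseteq> M"
    using B(2) v(1) frame_span_subset_iff[OF R M]
    by (auto simp: column_replace_column less_le)
  moreover have "ord_at A (det ?B) < ord_at A (det B)"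
    using k nz B(1) A by (simp add: det ord_at_mult mem_dvr_iff_ord)
  moreover have "det ?B \<noteq> 0"
    using nz B(1) by (simp add: det)
  ultimately show thesis
    using that by blast
qed

lemma lattice_order_strict_mono:
  assumes A: "discrete_valuation_ring A" and "lattice_at A N" "lattice_at A M" "N \<subset> M"
  shows "lattice_order A M < lattice_order A N"
proof -
  obtain B where B: "det B \<noteq> 0" "N = frame_span A B"
    using assms by (auto simp: lattice_at_def)
  obtain B' where B': "det B' \<noteq> 0" "frame_span A B' \<subseteq> M" "ord_at A (det B') < ord_at A (det B)"
    using frame_enlarge[OF A lattice_submodule[OF dvr_subring[OF A] assms(3)] B(1)] assms(4) B(2) by metis
  have "lattice_order A M \<le> lattice_order A (frame_span A B')"
    using assms B' by (intro lattice_order_mono) (auto simp: lattice_at_def)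
  then show ?thesis
    using B B' A by (simp add: lattice_order_frame_span)
qed

text \<open>
  Among the frames inside \<open>M\<close>, take one whose determinant has the smallest order. There is a lower bound
  because \<open>M \<subseteq> L\<close>, and by \<open>frame_enlarge\<close> the span is then all of \<open>M\<close>. This takes the place of the structure theory of
  modules over a principal ideal domain.
\<close>

lemma lattice_between:
  fixes M :: "('K::field^'n::finite) set"
  assumes A: "discrete_valuation_ring A" and M: "submodule_over A (*s) M"
    and "lattice_at A N" "lattice_at A L" "N \<subseteq> M" "M \<subseteq> L"
  shows "lattice_at A M"
proof -
  obtain B0 where B0: "det B0 \<noteq> 0" "N = frame_span A B0"
    using assms by (auto simp: lattice_at_def)
  define excess where "excess B = nat (ord_at A (det B) - lattice_order A L)" for B :: "'K^'n^'n"
  have excess: "int (excess B) = ord_at A (det B) - lattice_order A L"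
    if "det B \<noteq> 0" "frame_span A B \<subseteq> M" for B
  proof -
    have "lattice_order A L \<le> lattice_order A (frame_span A B)"
      using assms that by (intro lattice_order_mono) (auto simp: lattice_at_def)
    then show ?thesis
      using that A by (simp add: excess_def lattice_order_frame_span)
  qed
  let ?P = "\<lambda>B. det B \<noteq> 0 \<and> frame_span A B \<subseteq> M"
  obtain B where B: "?P B" and least: "\<And>B'. ?P B' \<Longrightarrow> excess B \<le> excess B'"
    using ex_has_least_nat[of ?P B0 excess] B0 assms(5) by auto
  have "frame_span A B = M"
  proof (rule ccontr)
    assume "frame_span A B \<noteq> M"
    then obtain B' where "det B' \<noteq> 0" "frame_span A B' \<subseteq> M" "ord_at A (det B') < ord_at A (det B)"
      using frame_enlarge[OF A M, of B] B by (metis less_le)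
    then show False
      using excess[of B] excess[of B'] B least[of B'] by simp
  qed
  then show ?thesis
    using B by (auto simp: lattice_at_def)
qed

lemma lattice_scaled:
  fixes M :: "('K::field^'n::finite) set"
  assumes "lattice_at A M" "t \<noteq> 0"
  shows "lattice_at A ((*s) t ` M)"
proof -
  obtain B where B: "det B \<noteq> 0" "M = frame_span A B"
    using assms by (auto simp: lattice_at_def)
  have "det (mat t :: 'K^'n^'n) \<noteq> 0"
    using assms(2) by (subst det_diagonal) (auto simp: mat_def)
  then have "det (mat t ** B) \<noteq> 0"
    using B by (simp add: det_mul)
  moreover have "mat t *v v = t *s v" for v :: "'K^'n"
    by (simp add: vec_eq_iff mat_def matrix_vector_mult_def if_distrib if_distribR cong: if_cong)
  then have "(*s) t ` M = frame_span A (mat t ** B)"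
    by (auto simp: B frame_span_def matrix_vector_mul_assoc[symmetric])
  ultimately show ?thesis
    by (auto simp: lattice_at_def)
qed

text \<open>
  The module \<open>N + A u\<close> has length at most one over \<open>N\<close>. In terms of frames: all coordinates of
  \<open>u\<close> have order at least \<open>-1\<close>, and \<open>u\<close> can replace a column at which the order is \<open>-1\<close>, since the replaced column is a
  combination, with coefficients in \<open>A\<close>, of \<open>u\<close> and the other columns.
\<close>

lemma lattice_adjoin_simple_pole:
  assumes A: "discrete_valuation_ring A" and N: "lattice_at A N"
    and u: "\<And>s. s \<in> max_ideal A \<Longrightarrow> s *s u \<in> N"
  obtains M where "lattice_at A M" "N \<subseteq> M" "u \<in> M" "lattice_order A N \<le> lattice_order A M + 1"
proof -
  note R = dvr_subring[OF A]
  obtain t where t: "uniformizer A t"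
    using A by (auto simp: discrete_valuation_ring_def)
  obtain B where B: "det B \<noteq> 0" "N = frame_span A B"
    using N by (auto simp: lattice_at_def)
  obtain c where c: "u = B *v c"
    using frame_coordinates[OF B(1)] .
  have tc: "t * c $ i \<in> A" for i
  proof -
    have "B *v (t *s c) \<in> frame_span A B"
      using u[OF uniformizer_in_max_ideal[OF t]] by (simp add: B c matrix_vector_scale)
    then obtain d where d: "B *v (t *s c) = B *v d" "\<forall>i. d $ i \<in> A"
      by (auto simp: frame_span_def)
    obtain B' where "B' ** B = mat 1"
      using frame_inverse[OF B(1)] .
    then have "t *s c = d"
      using arg_cong[OF d(1), of "(*v) B'"] by (simp add: matrix_vector_mul_assoc)
    then show ?thesis
      using d(2) by auto
  qed
  have ord_c: "- 1 \<le> ord_at A (c $ i)" if "c $ i \<noteq> 0" for i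
  proof -
    have "0 \<le> ord_at A (t * c $ i)"
      using tc[of i] that uniformizer_nonzero[OF t] A by (simp add: mem_dvr_iff_ord)
    then show ?thesis
      using that uniformizer_nonzero[OF t] A by (simp add: ord_at_mult ord_at_uniformizer[OF R t])
  qed
  show thesis
  proof (cases "\<forall>i. c $ i \<in> A")
    case True
    then show thesis
      using that[of N] N B c by (auto simp: frame_span_def)
  next
    case False
    then obtain k where k: "c $ k \<notin> A"
      by auto
    then have nz: "c $ k \<noteq> 0"
      using subring_zero[OF R] by auto
    have ord_k: "ord_at A (c $ k) = -1"
      using ord_c[OF nz] k nz A by (simp add: mem_dvr_iff_ord)
    let ?B = "replace_column k u B"
    let ?M = "frame_span A ?B"
    have det: "det ?B = c $ k * det B"
      by (simp add: c det_replace_column)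
    note M = submodule_frame_span[OF R, of ?B]
    have col: "column j ?B \<in> ?M" for j
      by (rule column_in_frame_span[OF R])
    have uM: "u \<in> ?M"
      using col[of k] by (simp add: column_replace_column)
    have other: "column j B \<in> ?M" if "j \<noteq> k" for j
      using col[of j] that by (simp add: column_replace_column)
    have quot: "c $ j / c $ k \<in> A" for j
      using ord_c[of j] ord_k nz A subring_zero[OF R]
      by (cases "c $ j = 0") (auto simp: mem_dvr_iff_ord ord_at_divide)
    have inv: "inverse (c $ k) \<in> A"
      using ord_k nz A by (simp add: mem_dvr_iff_ord ord_at_inverse)
    have "u = c $ k *s column k B + (\<Sum>j\<in>UNIV - {k}. c $ j *s column j B)"
      by (simp add: c matrix_mult_sum sum.remove[of UNIV k])
    then have "inverse (c $ k) *s u =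
        column k B + (\<Sum>j\<in>UNIV - {k}. (c $ j / c $ k) *s column j B)"
      using nz by (simp add: vec.scale_right_distrib vec.scale_sum_right divide_inverse mult.commute)
    then have "column k B =
        inverse (c $ k) *s u - (\<Sum>j\<in>UNIV - {k}. (c $ j / c $ k) *s column j B)"
      by simp
    moreover have "\<dots> \<in> ?M"
      using quot other inv uM
      by (intro submodule_diff[OF R M] submodule_sum[OF M] submodule_scale[OF M]) auto
    ultimately have "column j B \<in> ?M" for j
      using other by (cases "j = k") auto
    then have "N \<subseteq> ?M"
      by (simp add: B frame_span_subset_iff[OF R M])
    moreover have "lattice_order A N \<le> lattice_order A ?M + 1"
      using nz B ord_k A by (simp add: lattice_order_frame_span det ord_at_mult)
    moreover have "lattice_at A ?M"
      using nz B by (auto simp: lattice_at_def det intro!: exI[of _ ?B])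
    ultimately show thesis
      using that uM by blast
  qed
qed

lemma quotient_length_leI:
  assumes "\<And>n C. C 0 = N \<Longrightarrow> C n = M \<Longrightarrow> \<forall>i\<le>n. submodule_over A act (C i) \<Longrightarrow>
      \<forall>i<n. C i \<subset> C (Suc i) \<Longrightarrow> \<forall>i j. i \<le> j \<longrightarrow> j \<le> n \<longrightarrow> C i \<subseteq> C j \<Longrightarrow> n \<le> k"
  shows "quotient_length A act N M \<le> enat k"
  unfolding quotient_length_def
proof (rule Sup_least)
  fix l assume "l \<in> {enat n |n. \<exists>C. C 0 = N \<and> C n = M \<and>
      (\<forall>i\<le>n. submodule_over A act (C i)) \<and> (\<forall>i<n. C i \<subset> C (Suc i))}"
  then obtain n C where l: "l = enat n" and ends: "C 0 = N" "C n = M"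
    and C: "\<forall>i\<le>n. submodule_over A act (C i)" "\<forall>i<n. C i \<subset> C (Suc i)"
    by blast
  have "C i \<subseteq> C j" if "i \<le> j" "j \<le> n" for i j
    using that
  proof (induction rule: dec_induct)
    case (step k)
    then have "C k \<subset> C (Suc k)"
      using C(2) by simp
    then show ?case
      using step by auto
  qed simp
  then have "n \<le> k"
    using assms[OF ends C] by blast
  then show "l \<le> enat k"
    by (simp add: l)
qed

text \<open>
  All members of a chain from \<open>N\<close> to \<open>M\<close> are lattices, and the order of the determinant drops in every step.
\<close>

lemma quotient_length_le_lattice_order:
  assumes A: "discrete_valuation_ring A" and N: "lattice_at A N" and M: "lattice_at A M"
  shows "quotient_length A (*s) N M \<le> enat (nat (lattice_order A N - lattice_order A M))"
proof (rule quotient_length_leI)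
  fix n C
  assume ends: "C 0 = N" "C n = M" and C: "\<forall>i\<le>n. submodule_over A (*s) (C i)" "\<forall>i<n. C i \<subset> C (Suc i)"
    and mono: "\<forall>i j. i \<le> j \<longrightarrow> j \<le> n \<longrightarrow> C i \<subseteq> C j"
  have lat: "lattice_at A (C i)" if "i \<le> n" for i
    using C(1) that mono[rule_format, of 0 i] mono[rule_format, of i n]
    by (intro lattice_between[OF A _ N M]) (simp_all add: ends)
  have "int i \<le> lattice_order A (C 0) - lattice_order A (C i)" if "i \<le> n" for i
    using that
  proof (induction i)
    case (Suc i)
    have "lattice_order A (C (Suc i)) < lattice_order A (C i)"
      using Suc.prems C(2) by (intro lattice_order_strict_mono[OF A] lat) auto
    then show ?case
      using Suc by simp
  qed simp
  from this[of n] show "n \<le> nat (lattice_order A N - lattice_order A M)"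
    by (simp add: ends)
qed

section \<open>Neighbourhoods of rational points\<close>

lemma field_embedding_diff: "field_embedding \<iota> \<Longrightarrow> \<iota> (a - b) = \<iota> a - \<iota> b"
  unfolding field_embedding_def by (metis diff_add_cancel eq_diff_eq)

lemma field_embedding_zero: "field_embedding \<iota> \<Longrightarrow> \<iota> 0 = 0"
  using field_embedding_diff[of \<iota> 0 0] by simp

lemma field_embedding_inverse:
  assumes "field_embedding \<iota>" "\<iota> c \<noteq> 0"
  shows "\<iota> (inverse c) = inverse (\<iota> c)"
proof -
  have "c \<noteq> 0"
    using assms field_embedding_zero by blast
  then have "\<iota> c * \<iota> (inverse c) = 1"
    using assms(1) unfolding field_embedding_def by (metis right_inverse)
  then show ?thesis
    by (metis inverse_unique)
qed

lemma subring_adjoin: "subring_of_field (adjoin A S)"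
  unfolding subring_of_field_def
proof (intro conjI ballI)
  show "1 \<in> adjoin A S"
    by (auto simp: adjoin_def intro: subring_one)
  fix a b assume ab: "a \<in> adjoin A S" "b \<in> adjoin A S"
  show "a - b \<in> adjoin A S" "a * b \<in> adjoin A S"
    unfolding adjoin_def
  proof safe
    fix B assume B: "subring_of_field B" "A \<subseteq> B" "S \<subseteq> B"
    then have "a \<in> B" "b \<in> B"
      using ab unfolding adjoin_def by blast+
    then show "a - b \<in> B" "a * b \<in> B"
      using B(1) by (simp_all add: subring_diff subring_mult)
  qed
qed

lemma adjoin_supset: "A \<subseteq> adjoin A S" "S \<subseteq> adjoin A S"
  by (auto simp: adjoin_def)

lemma adjoin_least: "subring_of_field B \<Longrightarrow> A \<subseteq> B \<Longrightarrow> S \<subseteq> B \<Longrightarrow> adjoin A S \<subseteq> B"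
  by (auto simp: adjoin_def)

lemma subset_localization: "subring_of_field A \<Longrightarrow> prime_ideal_of A P \<Longrightarrow> A \<subseteq> localization_at A P"
proof
  fix a assume A: "subring_of_field A" "prime_ideal_of A P" and "a \<in> A"
  then have "a = a / 1" "a \<in> A" "1 \<in> A - P"
    by (auto simp: subring_one prime_ideal_of_def)
  then show "a \<in> localization_at A P"
    unfolding localization_at_def by blast
qed

lemma curve_closed_point_dvr:
  "smooth_projective_curve \<iota> X \<Longrightarrow> z \<in> X \<Longrightarrow> z \<noteq> UNIV \<Longrightarrow> discrete_valuation_ring z"
  unfolding smooth_projective_curve_def by blast

lemma curve_point_subring:
  assumes "smooth_projective_curve \<iota> X" "z \<in> X"
  shows "subring_of_field z"
  using curve_closed_point_dvr[OF assms] by (cases "z = UNIV") (simp_all add: subring_UNIV dvr_subring)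

lemma curve_affine_chart:
  assumes "smooth_projective_curve \<iota> X" "z \<in> X"
  obtains S P where "finite S" "prime_ideal_of (adjoin (range \<iota>) S) P"
    "z = localization_at (adjoin (range \<iota>) S) P"
proof -
  from assms obtain S where "finite S" "z \<in> fst ` proj_with_O1 (range \<iota>) S"
    unfolding smooth_projective_curve_def by blast
  then obtain f P where P: "prime_ideal_of (adjoin (range \<iota>) ((\<lambda>g. g / f) ` S)) P"
    "z = localization_at (adjoin (range \<iota>) ((\<lambda>g. g / f) ` S)) P"
    by (auto simp: proj_with_O1_def)
  show thesis
    by (rule that[OF _ P]) (simp add: \<open>finite S\<close>)
qed

lemma curve_point_contains_constants:
  assumes "smooth_projective_curve \<iota> X" "z \<in> X"
  shows "\<iota> c \<in> z"
proof -
  obtain S P where P: "prime_ideal_of (adjoin (range \<iota>) S) P"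
    and z: "z = localization_at (adjoin (range \<iota>) S) P"
    using curve_affine_chart[OF assms] .
  have "\<iota> c \<in> adjoin (range \<iota>) S"
    using adjoin_supset(1)[of "range \<iota>" S] by auto
  then show ?thesis
    using subset_localization[OF subring_adjoin P] z by auto
qed

lemma openin_zariski_finite_subset:
  assumes "\<And>z. z \<in> X \<Longrightarrow> subring_of_field z" "finite F"
  shows "openin (zariski X) {z \<in> X. F \<subseteq> z}"
  using assms(2)
proof induction
  case empty
  have "{z \<in> X. {} \<subseteq> z} = {z \<in> X. 1 \<in> z}"
    using assms(1) subring_one by auto
  also have "openin (zariski X) \<dots>"
    unfolding zariski_def by (rule topology_generated_by_Basis) auto
  finally show ?case .
next
  case (insert f F)
  have "openin (zariski X) {z \<in> X. f \<in> z}"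
    unfolding zariski_def by (rule topology_generated_by_Basis) auto
  then have "openin (zariski X) ({z \<in> X. f \<in> z} \<inter> {z \<in> X. F \<subseteq> z})"
    using insert.IH by (rule openin_Int)
  also have "{z \<in> X. f \<in> z} \<inter> {z \<in> X. F \<subseteq> z} = {z \<in> X. insert f F \<subseteq> z}"
    by auto
  finally show ?case .
qed

text \<open>
  By maximality of discrete valuation rings, each point of \<open>Y\<close> misses some function that is regular at \<open>z\<close>.
\<close>

lemma curve_closed_points_closed:
  assumes X: "smooth_projective_curve \<iota> X" and z: "z \<in> X"
    and Y: "finite Y" "Y \<subseteq> X - {UNIV}" "z \<notin> Y"
  obtains F where "finite F" "F \<subseteq> z" "\<And>y. y \<in> Y \<Longrightarrow> \<not> F \<subseteq> y"
proof -
  have "\<exists>f. f \<in> z \<and> f \<notin> y" if "y \<in> Y" for y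
  proof (rule ccontr)
    assume "\<not> (\<exists>f. f \<in> z \<and> f \<notin> y)"
    then have sub: "z \<subseteq> y"
      by auto
    have y: "y \<in> X" "y \<noteq> UNIV" "y \<noteq> z"
      using that Y by auto
    then have "z \<noteq> UNIV"
      using sub by auto
    then have "y = z \<or> y = UNIV"
      using dvr_maximal_subring[OF curve_closed_point_dvr[OF X z] curve_point_subring[OF X y(1)] sub]
      by simp
    then show False
      using y by simp
  qed
  then obtain f where f: "\<And>y. y \<in> Y \<Longrightarrow> f y \<in> z \<and> f y \<notin> y"
    by metis
  show thesis
  proof (rule that)
    show "finite (f ` Y)" "f ` Y \<subseteq> z"
      using f Y(1) by auto
    show "\<not> f ` Y \<subseteq> y" if "y \<in> Y" for y
      using f that by blast
  qed
qed

lemma rational_point_dvr: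
  "smooth_projective_curve \<iota> X \<Longrightarrow> rational_point \<iota> X x \<Longrightarrow> discrete_valuation_ring x"
  by (simp add: rational_point_def curve_closed_point_dvr)

text \<open>
  Let \<open>S\<close> generate the coordinate ring \<open>A\<close> of an affine chart around \<open>x\<close>, and let \<open>\<kappa> s\<close> be the value of \<open>s\<close> at
  \<open>x\<close>. The functions \<open>s - \<kappa> s\<close> generate the maximal ideal of \<open>x\<close> in \<open>A\<close>. If they
  vanish at \<open>y\<close> too, then every element of \<open>A\<close> has the same value in \<open>k\<close> at \<open>x\<close> and at \<open>y\<close>.
  So denominators that are units at \<open>x\<close> are units at \<open>y\<close>, and the local ring of
  \<open>x\<close> is contained in that of \<open>y\<close>.
\<close>

lemma rational_point_local_equations:
  assumes X: "smooth_projective_curve \<iota> X" and x: "rational_point \<iota> X x"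
  obtains S where "finite S" "S \<subseteq> max_ideal x"
    "\<forall>y\<in>X - {UNIV}. S \<subseteq> max_ideal y \<longrightarrow> y = x"
proof -
  have i: "field_embedding \<iota>"
    using X by (simp add: smooth_projective_curve_def)
  have xX: "x \<in> X"
    using x by (simp add: rational_point_def)
  note dx = rational_point_dvr[OF X x]
  note Rx = dvr_subring[OF dx]
  obtain S P where S: "finite S" and P: "prime_ideal_of (adjoin (range \<iota>) S) P"
    and x_eq: "x = localization_at (adjoin (range \<iota>) S) P"
    using curve_affine_chart[OF X xX] .
  define A where "A = adjoin (range \<iota>) S"
  have A: "subring_of_field A" "A \<subseteq> x"
    using subset_localization[OF _ P] by (auto simp: A_def x_eq subring_adjoin)
  have "\<exists>\<kappa>. \<forall>s\<in>x. s - \<iota> (\<kappa> s) \<in> max_ideal x"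
    using x by (intro bchoice) (simp add: rational_point_def)
  then obtain \<kappa> where \<kappa>: "\<And>s. s \<in> x \<Longrightarrow> s - \<iota> (\<kappa> s) \<in> max_ideal x"
    by auto
  have SA: "S \<subseteq> A"
    unfolding A_def by (rule adjoin_supset)
  show thesis
  proof (rule that)
    show "finite ((\<lambda>s. s - \<iota> (\<kappa> s)) ` S)"
      using S by simp
    show "(\<lambda>s. s - \<iota> (\<kappa> s)) ` S \<subseteq> max_ideal x"
      using \<kappa> SA A(2) by auto
  next
    show "\<forall>y\<in>X - {UNIV}. (\<lambda>s. s - \<iota> (\<kappa> s)) ` S \<subseteq> max_ideal y \<longrightarrow> y = x"
    proof (intro ballI impI)
      fix y assume y': "y \<in> X - {UNIV}" and sub: "(\<lambda>s. s - \<iota> (\<kappa> s)) ` S \<subseteq> max_ideal y"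
      then have y: "y \<in> X" "y \<noteq> UNIV"
        by auto
      have dy: "discrete_valuation_ring y"
        using X y by (auto simp: smooth_projective_curve_def)
      note Ry = dvr_subring[OF dy]
      define C where "C = {b. \<exists>c. b - \<iota> c \<in> max_ideal x \<inter> max_ideal y}"
      have mixed: "b * b' - \<iota> (c * c') \<in> max_ideal z"
        if "z \<in> X" "discrete_valuation_ring z" "b - \<iota> c \<in> max_ideal z" "b' - \<iota> c' \<in> max_ideal z"
        for z b b' c c'
      proof -
        have "b' = (b' - \<iota> c') + \<iota> c'"
          by simp
        then have b': "b' \<in> z"
          using that max_ideal_subset curve_point_contains_constants[OF X that(1)]
            subring_add[OF dvr_subring[OF that(2)]] by (metis subsetD)
        have "b * b' - \<iota> (c * c') = b' * (b - \<iota> c) + \<iota> c * (b' - \<iota> c')"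
          using i by (simp add: field_embedding_def algebra_simps)
        also have "\<dots> \<in> max_ideal z"
          using that b' curve_point_contains_constants[OF X that(1)]
          by (intro max_ideal_add max_ideal_mult) auto
        finally show ?thesis .
      qed
      have diff: "b - b' - \<iota> (c - c') \<in> max_ideal z"
        if "discrete_valuation_ring z" "b - \<iota> c \<in> max_ideal z" "b' - \<iota> c' \<in> max_ideal z"
        for z b b' c c'
      proof -
        have "b - b' - \<iota> (c - c') = (b - \<iota> c) + (- 1) * (b' - \<iota> c')"
          by (simp add: field_embedding_diff[OF i])
        also have "\<dots> \<in> max_ideal z"
          using that dvr_subring[OF that(1)]
          by (intro max_ideal_add max_ideal_mult) (auto intro: subring_uminus subring_one)
        finally show ?thesis .
      qed
      have "subring_of_field C"
        unfolding subring_of_field_def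
      proof (intro conjI ballI)
        have "1 - \<iota> 1 = 0"
          using i by (simp add: field_embedding_def)
        then have "1 - \<iota> 1 \<in> max_ideal x \<inter> max_ideal y"
          using max_ideal_zero[OF dx] max_ideal_zero[OF dy] by simp
        then show "1 \<in> C"
          unfolding C_def by blast
        fix a b assume "a \<in> C" "b \<in> C"
        then obtain c d where cd: "a - \<iota> c \<in> max_ideal x \<inter> max_ideal y" "b - \<iota> d \<in> max_ideal x \<inter> max_ideal y"
          by (auto simp: C_def)
        show "a - b \<in> C"
          using diff[OF dx, of a c b d] diff[OF dy, of a c b d] cd unfolding C_def by blast
        show "a * b \<in> C"
          using mixed[OF xX dx, of a c b d] mixed[OF y(1) dy, of a c b d] cd unfolding C_def by blast
      qed
      moreover have "range \<iota> \<subseteq> C"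
      proof
        fix b assume "b \<in> range \<iota>"
        then obtain c where "b - \<iota> c = 0"
          by auto
        moreover have "0 \<in> max_ideal x \<inter> max_ideal y"
          using max_ideal_zero[OF dx] max_ideal_zero[OF dy] by simp
        ultimately show "b \<in> C"
          unfolding C_def by (metis (mono_tags, lifting) mem_Collect_eq)
      qed
      moreover have "S \<subseteq> C"
      proof
        fix s assume "s \<in> S"
        then have "s - \<iota> (\<kappa> s) \<in> max_ideal x \<inter> max_ideal y"
          using sub \<kappa> SA A(2) by blast
        then show "s \<in> C"
          unfolding C_def by blast
      qed
      ultimately have AC: "A \<subseteq> C"
        unfolding A_def by (rule adjoin_least)
      have residue: "b \<in> y \<and> (b \<in> max_ideal y \<longrightarrow> b \<in> max_ideal x)" if b: "b \<in> A" for b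
      proof -
        obtain c where c: "b - \<iota> c \<in> max_ideal x" "b - \<iota> c \<in> max_ideal y"
          using AC b by (auto simp: C_def)
        have "b = (b - \<iota> c) + \<iota> c"
          by simp
        then have by': "b \<in> y"
          using c max_ideal_subset curve_point_contains_constants[OF X y(1)]
            subring_add[OF Ry] by (metis subsetD)
        moreover have "b \<in> max_ideal x" if m: "b \<in> max_ideal y"
        proof -
          have "\<iota> c = b + (- 1) * (b - \<iota> c)"
            by simp
          also have "\<dots> \<in> max_ideal y"
            using m c by (intro max_ideal_add[OF dy] max_ideal_mult[OF dy])
              (auto intro: subring_uminus[OF Ry] subring_one[OF Ry])
          finally have "\<iota> c \<in> max_ideal y" .
          then have "\<iota> c = 0"
            using field_embedding_inverse[OF i, of c] curve_point_contains_constants[OF X y(1), of "inverse c"]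
            by (cases "\<iota> c = 0") (auto simp: max_ideal_def)
          then show ?thesis
            using c by simp
        qed
        ultimately show ?thesis
          by simp
      qed
      have "x \<subseteq> y"
      proof
        fix f assume "f \<in> x"
        then obtain a b where ab: "f = a / b" "a \<in> A" "b \<in> A" "b \<notin> P"
          by (auto simp: x_eq localization_at_def A_def)
        have "1 / b \<in> x"
          using ab subring_one[OF A(1)] by (auto simp: x_eq localization_at_def A_def)
        moreover have "b \<noteq> 0"
          using ab P by (auto simp: prime_ideal_of_def)
        ultimately have "b \<notin> max_ideal x"
          by (simp add: max_ideal_def inverse_eq_divide)
        then have "inverse b \<in> y"
          using residue[OF ab(3)] by (auto simp: max_ideal_def)
        then show "f \<in> y"
          using residue[OF ab(2)] by (simp add: ab(1) divide_inverse subring_mult[OF Ry])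
      qed
      then show "y = x"
        using dvr_maximal_subring[OF dx Ry] y by auto
    qed
  qed
qed

text \<open>
  If \<open>n\<close> is at least the order of the pole of \<open>g\<close> at \<open>x\<close>, then \<open>s\<^sup>n g\<close> is regular at \<open>x\<close> for each of the finitely many
  local equations \<open>s\<close> of \<open>x\<close>. These are the conditions that define \<open>F\<close>: at \<open>y \<noteq> x\<close> some \<open>s\<close> is a unit, so that \<open>g\<close> is
  regular at \<open>y\<close>.
\<close>

lemma regular_near_rational_point:
  assumes X: "smooth_projective_curve \<iota> X" and x: "rational_point \<iota> X x"
  obtains F where "finite F" "F \<subseteq> x" "\<And>y. y \<in> X \<Longrightarrow> F \<subseteq> y \<Longrightarrow> y \<noteq> x \<Longrightarrow> g \<in> y"
proof -
  note dx = rational_point_dvr[OF X x]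
  note Rx = dvr_subring[OF dx]
  obtain S where S: "finite S" "S \<subseteq> max_ideal x"
    "\<forall>y\<in>X - {UNIV}. S \<subseteq> max_ideal y \<longrightarrow> y = x"
    by (rule rational_point_local_equations[OF X x])
  obtain t where t: "uniformizer x t"
    using dx by (auto simp: discrete_valuation_ring_def)
  obtain n where n: "t ^ n * g \<in> x"
  proof (cases "g = 0")
    case False
    then obtain u m where u: "u \<in> x" "g = u * t powi m"
      using uniformizer_decomposition[OF t] by metis
    have "t ^ nat \<bar>m\<bar> * g = u * t powi (\<bar>m\<bar> + m)"
      using uniformizer_nonzero[OF t] u by (simp add: power_int_nonneg_exp[symmetric] power_int_add)
    also have "\<dots> \<in> x"
      using u uniformizer_powi_mem_iff[OF Rx t] by (auto intro: subring_mult[OF Rx])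
    finally show thesis
      by (rule that)
  qed (use that[of 0] subring_zero[OF Rx] in simp)
  have "s ^ n * g \<in> x" if "s \<in> S" for s
  proof -
    have "s ^ n * g = (s / t) ^ n * (t ^ n * g)"
      using uniformizer_nonzero[OF t] by (simp add: power_divide)
    also have "\<dots> \<in> x"
      using that S(2) mem_max_ideal_iff[OF dx t] n by (auto intro!: subring_mult[OF Rx] subring_power[OF Rx])
    finally show ?thesis .
  qed
  then have sub: "S \<union> (\<lambda>s. s ^ n * g) ` S \<subseteq> x"
    using S(2) max_ideal_subset by fast
  show thesis
  proof (rule that[OF _ sub])
    fix y assume y: "y \<in> X" "S \<union> (\<lambda>s. s ^ n * g) ` S \<subseteq> y" "y \<noteq> x"
    show "g \<in> y"
    proof (cases "y = UNIV")
      case False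
      then obtain s where s: "s \<in> S" "s \<notin> max_ideal y"
        using S(3) y by blast
      note Ry = curve_point_subring[OF X y(1)]
      have "inverse s \<in> y" "s \<noteq> 0"
        using s y(2) by (auto simp: max_ideal_def)
      moreover have "s ^ n * g \<in> y"
        using y(2) s by auto
      ultimately have "inverse s ^ n * (s ^ n * g) \<in> y"
        using subring_mult[OF Ry subring_power[OF Ry]] by blast
      then show ?thesis
        using \<open>s \<noteq> 0\<close> by (simp add: mult.assoc[symmetric] power_mult_distrib[symmetric])
    qed simp
  qed (use S in simp)
qed

section \<open>Modifying a bundle at rational points\<close>

lemma vector_bundle_stalk:
  assumes "vector_bundle X V" "z \<in> X"
  shows "lattice_at z (V z)"
  using assms unfolding vector_bundle_def lattice_at_def by metis

text \<open>
  At \<open>z \<in> Y\<close>, the transition matrices between a frame of \<open>V\<close> near \<open>z\<close> and a frame of the new stalk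
  have only finitely many entries, which are regular on a punctured neighbourhood of \<open>z\<close>. There the two frames span the same
  stalks.
\<close>

lemma vector_bundle_modify:
  fixes V V' :: "('K::field, 'n::finite) lattice_sheaf"
  assumes X: "smooth_projective_curve \<iota> X" and V: "vector_bundle X V"
    and Y: "finite Y" "\<And>y. y \<in> Y \<Longrightarrow> rational_point \<iota> X y"
    and outside: "\<And>z. z \<in> X \<Longrightarrow> z \<notin> Y \<Longrightarrow> V' z = V z"
    and inside: "\<And>y. y \<in> Y \<Longrightarrow> lattice_at y (V' y)"
  shows "vector_bundle X V'"
  unfolding vector_bundle_def
proof
  fix z assume z: "z \<in> X"
  have YX: "Y - {z} \<subseteq> X - {UNIV}"
    using Y(2) by (auto simp: rational_point_def)
  obtain U B where U: "openin (zariski X) U" "z \<in> U" "det B \<noteq> 0" "\<And>y. y \<in> U \<Longrightarrow> V y = frame_span y B"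
    using V z unfolding vector_bundle_def by metis
  obtain F where F: "finite F" "F \<subseteq> z" "\<And>y. y \<in> Y - {z} \<Longrightarrow> \<not> F \<subseteq> y"
    using curve_closed_points_closed[OF X z _ YX] Y(1) by auto
  note open_nbhd = openin_zariski_finite_subset[OF curve_point_subring[OF X]]
  have UX: "U \<subseteq> X"
  proof -
    have "topspace (zariski X) \<subseteq> X"
      unfolding zariski_def topology_generated_by_topspace by auto
    then show ?thesis
      using openin_subset[OF U(1)] by auto
  qed
  show "\<exists>U B. openin (zariski X) U \<and> z \<in> U \<and> det B \<noteq> 0 \<and> (\<forall>y\<in>U. V' y = frame_span y B)"
  proof (cases "z \<in> Y")
    case False
    let ?U = "U \<inter> {y \<in> X. F \<subseteq> y}"
    have "openin (zariski X) ?U"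
      using U(1) open_nbhd[OF _ F(1)] by auto
    moreover have "z \<in> ?U"
      using U(2) z F(2) by auto
    moreover have "V' y = frame_span y B" if "y \<in> ?U" for y
      using that outside[of y] F(3)[of y] U(4)[of y] False by auto
    ultimately show ?thesis
      using U(3) by blast
  next
    case True
    obtain B' where B': "det B' \<noteq> 0" "V' z = frame_span z B'"
      using inside[OF True] by (auto simp: lattice_at_def)
    obtain C where C: "C ** B = mat 1" "B ** C = mat 1"
      using frame_inverse[OF U(3)] by metis
    obtain C' where C': "C' ** B' = mat 1" "B' ** C' = mat 1"
      using frame_inverse[OF B'(1)] by metis
    define entries where "entries = range (\<lambda>(i, j). (C ** B') $ i $ j) \<union> range (\<lambda>(i, j). (C' ** B) $ i $ j)"
    have "finite entries"
      by (simp add: entries_def)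
    have "\<exists>G. finite G \<and> G \<subseteq> z \<and> (\<forall>y. y \<in> X \<longrightarrow> G \<subseteq> y \<longrightarrow> y \<noteq> z \<longrightarrow> g \<in> y)" for g
      using regular_near_rational_point[OF X Y(2)[OF True], of g] by metis
    then obtain G where G: "\<And>g. finite (G g)" "\<And>g. G g \<subseteq> z"
      "\<And>g y. y \<in> X \<Longrightarrow> G g \<subseteq> y \<Longrightarrow> y \<noteq> z \<Longrightarrow> g \<in> y"
      by metis
    define F' where "F' = F \<union> (\<Union>g\<in>entries. G g)"
    have F': "finite F'" "F' \<subseteq> z"
      using F(1,2) G(1,2) \<open>finite entries\<close> unfolding F'_def by (blast intro: finite_UN_I)+
    let ?U = "U \<inter> {y \<in> X. F' \<subseteq> y}"
    have "openin (zariski X) ?U"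
      using U(1) open_nbhd[OF _ F'(1)] by auto
    moreover have "z \<in> ?U"
      using U(2) z F'(2) by auto
    moreover have "V' y = frame_span y B'" if y: "y \<in> ?U" for y
    proof (cases "y = z")
      case False
      have R: "subring_of_field y"
        using y curve_point_subring[OF X] by auto
      have "entries \<subseteq> y"
      proof
        fix g assume "g \<in> entries"
        then have "G g \<subseteq> y"
          using y unfolding F'_def by blast
        then show "g \<in> y"
          using G(3) y False by blast
      qed
      then have "(C ** B') $ i $ j \<in> y" "(C' ** B) $ i $ j \<in> y" for i j
        unfolding entries_def by fast+
      then have "frame_span y (B ** (C ** B')) \<subseteq> frame_span y B"
        "frame_span y (B' ** (C' ** B)) \<subseteq> frame_span y B'"
        by (auto intro!: frame_span_mult_subset[OF R])
      then have "frame_span y B' = frame_span y B"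
        using C C' by (simp add: matrix_mul_assoc)
      moreover have "y \<notin> Y"
        using F(3)[of y] y False by (auto simp: F'_def)
      ultimately show ?thesis
        using y outside[of y] U(4)[of y] by simp
    qed (use B' in simp)
    ultimately show ?thesis
      using B'(1) by blast
  qed
qed

section \<open>Principal parts of rank one\<close>

lemma as_matrix_add: "as_matrix (g + h) = as_matrix g + as_matrix h"
  by (simp add: as_matrix_def vec_eq_iff)

lemma as_matrix_zero: "as_matrix 0 = 0"
  by (simp add: as_matrix_def vec_eq_iff)

lemma as_matrix_scale_vector: "as_matrix (c *s h) *v v = c *s (as_matrix h *v v)"
  by (simp add: as_matrix_def vec_eq_iff matrix_vector_mult_def sum_distrib_left mult.assoc)

lemma as_matrix_sum_vector: "as_matrix (\<Sum>i\<in>I. h i) *v v = (\<Sum>i\<in>I. as_matrix (h i) *v v)"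
  by (induction I rule: infinite_finite_induct)
    (simp_all add: as_matrix_add as_matrix_zero matrix_vector_mult_add_rdistrib)

lemma submodule_hom_bundle:
  assumes "submodule_over A (*s) (V1 z)"
  shows "submodule_over A (*s) (hom_bundle V2 V1 z)"
  unfolding submodule_over_def hom_bundle_def
  using submodule_zero[OF assms] submodule_add[OF assms] submodule_scale[OF assms]
  by (auto simp: as_matrix_zero as_matrix_add as_matrix_scale_vector matrix_vector_mult_add_rdistrib)

text \<open>
  The principal part of \<open>P : L\<^sub>2 \<rightarrow> Rat(L\<^sub>1)\<close> takes its values in the line of \<open>m\<^sup>-\<^sup>1 L\<^sub>1 / L\<^sub>1\<close> that is spanned by some \<open>u\<close>;
  the case \<open>u \<in> L\<^sub>1\<close>, where \<open>P\<close> is regular, is included.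
\<close>

definition pole_along_line :: "'K::field set \<Rightarrow> ('K^'b::finite) set \<Rightarrow> ('K^'a::finite) set \<Rightarrow> 'K^'b^'a \<Rightarrow> bool" where
  "pole_along_line A L2 L1 P \<longleftrightarrow>
     (\<exists>u. (\<forall>s\<in>max_ideal A. s *s u \<in> L1) \<and> (\<forall>v\<in>L2. \<exists>r\<in>A. P *v v - r *s u \<in> L1))"

lemma fibre_kernel_uniformizer:
  assumes A: "discrete_valuation_ring x" and t: "uniformizer x t" and V: "submodule_over x (*s) (V x)"
  shows "fibre_kernel x V = (*s) t ` V x"
proof
  show "fibre_kernel x V \<subseteq> (*s) t ` V x"
  proof
    fix v assume "v \<in> fibre_kernel x V"
    then obtain s w where s: "v = s *s w" "s \<in> max_ideal x" "w \<in> V x"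
      by (auto simp: fibre_kernel_def)
    then have "v = t *s ((s / t) *s w)" "(s / t) *s w \<in> V x"
      using uniformizer_nonzero[OF t] mem_max_ideal_iff[OF A t] submodule_scale[OF V]
      by (auto simp: vector_smult_assoc)
    then show "v \<in> (*s) t ` V x"
      by blast
  qed
  show "(*s) t ` V x \<subseteq> fibre_kernel x V"
    using uniformizer_in_max_ideal[OF t] by (auto simp: fibre_kernel_def)
qed

lemma submodule_scaled:
  fixes M :: "('K::field^'n::finite) set"
  assumes "submodule_over A (*s) M"
  shows "submodule_over A (*s) ((*s) t ` M)"
  unfolding submodule_over_def
proof (intro conjI ballI)
  show "0 \<in> (*s) t ` M"
    using submodule_zero[OF assms] by (intro image_eqI[of _ _ 0]) simp_all
  fix v assume "v \<in> (*s) t ` M"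
  then obtain v' where v': "v = t *s v'" "v' \<in> M"
    by auto
  show "v + w \<in> (*s) t ` M" if "w \<in> (*s) t ` M" for w
  proof -
    obtain w' where "w = t *s w'" "w' \<in> M"
      using \<open>w \<in> (*s) t ` M\<close> by auto
    then have "v + w = t *s (v' + w')" "v' + w' \<in> M"
      using v' submodule_add[OF assms] by (simp_all add: vec.scale_right_distrib)
    then show ?thesis
      by blast
  qed
  show "a *s v \<in> (*s) t ` M" if "a \<in> A" for a
  proof (rule image_eqI)
    show "a *s v = t *s (a *s v')"
      by (simp add: v' vector_smult_assoc mult.commute)
  qed (use v' that submodule_scale[OF assms] in simp)
qed

lemma submodule_adjoin_vector:
  fixes N :: "('K::field^'n::finite) set"
  assumes A: "subring_of_field A" and N: "submodule_over A (*s) N"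
  shows "submodule_over A (*s) {r *s u + w |r w. r \<in> A \<and> w \<in> N}"
  unfolding submodule_over_def
proof (intro conjI ballI)
  show "0 \<in> {r *s u + w |r w. r \<in> A \<and> w \<in> N}"
    using subring_zero[OF A] submodule_zero[OF N] by (auto intro!: exI[of _ 0])
  fix v assume "v \<in> {r *s u + w |r w. r \<in> A \<and> w \<in> N}"
  then obtain r w where v: "v = r *s u + w" "r \<in> A" "w \<in> N"
    by auto
  show "v + v' \<in> {r *s u + w |r w. r \<in> A \<and> w \<in> N}"
    if v': "v' \<in> {r *s u + w |r w. r \<in> A \<and> w \<in> N}" for v'
  proof -
    obtain r' w' where "v' = r' *s u + w'" "r' \<in> A" "w' \<in> N"
      using v' by auto
    then have "v + v' = (r + r') *s u + (w + w')" "r + r' \<in> A" "w + w' \<in> N"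
      using v subring_add[OF A] submodule_add[OF N] by (auto simp: vec.scale_left_distrib)
    then show ?thesis
      by blast
  qed
  show "a *s v \<in> {r *s u + w |r w. r \<in> A \<and> w \<in> N}" if "a \<in> A" for a
  proof -
    have "a *s v = (a * r) *s u + a *s w" "a * r \<in> A" "a *s w \<in> N"
      using v that subring_mult[OF A] submodule_scale[OF N]
      by (auto simp: vec.scale_right_distrib vector_smult_assoc)
    then show ?thesis
      by blast
  qed
qed

lemma submodule_image_plus:
  fixes P :: "'K::field^'b::finite^'a::finite"
  assumes L2: "submodule_over A (*s) L2" and L1: "submodule_over A (*s) L1"
  shows "submodule_over A (*s) {P *v v + w |v w. v \<in> L2 \<and> w \<in> L1}"
  unfolding submodule_over_def
proof (intro conjI ballI)
  show "0 \<in> {P *v v + w |v w. v \<in> L2 \<and> w \<in> L1}"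
    using submodule_zero[OF L2] submodule_zero[OF L1] by (auto intro!: exI[of _ 0])
  fix v assume "v \<in> {P *v v + w |v w. v \<in> L2 \<and> w \<in> L1}"
  then obtain r w where v: "v = P *v r + w" "r \<in> L2" "w \<in> L1"
    by auto
  show "v + v' \<in> {P *v v + w |v w. v \<in> L2 \<and> w \<in> L1}"
    if v': "v' \<in> {P *v v + w |v w. v \<in> L2 \<and> w \<in> L1}" for v'
  proof -
    obtain r' w' where "v' = P *v r' + w'" "r' \<in> L2" "w' \<in> L1"
      using v' by auto
    then have "v + v' = P *v (r + r') + (w + w')" "r + r' \<in> L2" "w + w' \<in> L1"
      using v submodule_add[OF L2] submodule_add[OF L1] by (auto simp: matrix_vector_right_distrib)
    then show ?thesis
      by blast
  qed
  show "a *s v \<in> {P *v v + w |v w. v \<in> L2 \<and> w \<in> L1}" if "a \<in> A" for a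
  proof -
    have "a *s v = P *v (a *s r) + a *s w" "a *s r \<in> L2" "a *s w \<in> L1"
      using v that submodule_scale[OF L2] submodule_scale[OF L1]
      by (auto simp: vec.scale_right_distrib matrix_vector_scale)
    then show ?thesis
      by blast
  qed
qed

lemma submodule_preimage:
  fixes P :: "'K::field^'b::finite^'a::finite"
  assumes L2: "submodule_over A (*s) L2" and L1: "submodule_over A (*s) L1"
  shows "submodule_over A (*s) {v \<in> L2. P *v v \<in> L1}"
  unfolding submodule_over_def
  using submodule_zero[OF L2] submodule_zero[OF L1] submodule_add[OF L2] submodule_add[OF L1]
    submodule_scale[OF L2] submodule_scale[OF L1]
  by (auto simp: matrix_vector_right_distrib matrix_vector_scale)

text \<open>
  Let \<open>H = t g\<close>. If \<open>H v\<^sub>0\<close> is nonzero in the fibre, it spans the image of \<open>H\<close> on fibres, for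
  otherwise there would be a chain of length two. Then \<open>u = g v\<^sub>0 = H v\<^sub>0 / t\<close> spans the line of the poles of \<open>g\<close>.
\<close>

lemma pole_along_line_if_fibre_rank:
  assumes A: "discrete_valuation_ring x" and t: "uniformizer x t"
    and V1: "submodule_over x (*s) (V1 x)" and V2: "submodule_over x (*s) (V2 x)"
    and hom: "t *s g \<in> hom_bundle V2 V1 x" and rank: "fibre_rank x V2 V1 (t *s g) \<le> 1"
  shows "pole_along_line x (V2 x) (V1 x) (as_matrix g)"
proof -
  note R = dvr_subring[OF A]
  have t0: "t \<noteq> 0"
    using t by (rule uniformizer_nonzero)
  define H where "H = as_matrix (t *s g)"
  have H: "H *v v = t *s (as_matrix g *v v)" for v
    by (simp add: H_def as_matrix_scale_vector)
  have HV1: "H *v v \<in> V1 x" if "v \<in> V2 x" for v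
    using hom that by (simp add: hom_bundle_def H_def)
  define N where "N = (*s) t ` V1 x"
  have kernel: "fibre_kernel x V1 = N"
    unfolding N_def by (rule fibre_kernel_uniformizer[of x t V1, OF A t V1])
  have N: "submodule_over x (*s) N"
    unfolding N_def by (rule submodule_scaled[OF V1])
  define M where "M = {H *v v + w |v w. v \<in> V2 x \<and> w \<in> N}"
  have M: "submodule_over x (*s) M"
    unfolding M_def by (rule submodule_image_plus[OF V2 N])
  show ?thesis
  proof (cases "\<forall>v\<in>V2 x. H *v v \<in> N")
    case True
    have "as_matrix g *v v \<in> V1 x" if "v \<in> V2 x" for v
      using True that t0 by (auto simp: N_def H)
    then show ?thesis
      using submodule_zero[OF V1] subring_zero[OF R]
      unfolding pole_along_line_def by (auto intro!: exI[of _ 0])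
  next
    case False
    then obtain v0 where v0: "v0 \<in> V2 x" "H *v v0 \<notin> N"
      by auto
    define N' where "N' = {r *s (H *v v0) + w |r w. r \<in> x \<and> w \<in> N}"
    have N': "submodule_over x (*s) N'"
      unfolding N'_def by (rule submodule_adjoin_vector[OF R N])
    have "1 *s (H *v v0) + 0 \<in> N'"
      unfolding N'_def using subring_one[OF R] submodule_zero[OF N] by blast
    moreover have "0 *s (H *v v0) + w \<in> N'" if "w \<in> N" for w
      unfolding N'_def using subring_zero[OF R] that by blast
    ultimately have "N \<subset> N'"
      using v0 by auto
    have sub: "N' \<subseteq> M"
    proof
      fix w assume "w \<in> N'"
      then obtain r n where w: "w = r *s (H *v v0) + n" "r \<in> x" "n \<in> N"
        by (auto simp: N'_def)
      then have "w = H *v (r *s v0) + n" "r *s v0 \<in> V2 x"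
        using v0 submodule_scale[OF V2] by (auto simp: matrix_vector_scale)
      then show "w \<in> M"
        using w unfolding M_def by blast
    qed
    \<comment> \<open>otherwise \<open>N \<subset> N' \<subset> M\<close> shows that the image has dimension at least two\<close>
    have "N' = M"
    proof (rule ccontr)
      assume "N' \<noteq> M"
      define C where "C i = (if i = 0 then N else if i = 1 then N' else M)" for i :: nat
      have "C 0 = N" "C 2 = M" "\<forall>i\<le>2. submodule_over x (*s) (C i)"
        using N N' M by (auto simp: C_def)
      moreover have "\<forall>i<2. C i \<subset> C (Suc i)"
        using \<open>N \<subset> N'\<close> sub \<open>N' \<noteq> M\<close> by (auto simp: C_def less_Suc_eq numeral_2_eq_2)
      ultimately have "enat 2 \<le> quotient_length x (*s) N M"
        unfolding quotient_length_def by (intro Sup_upper) blast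
      also have "\<dots> = fibre_rank x V2 V1 (t *s g)"
        by (simp add: fibre_rank_def kernel M_def H_def)
      also have "\<dots> \<le> 1"
        by (rule rank)
      finally show False
        by (simp add: one_enat_def)
    qed
    define u where "u = as_matrix g *v v0"
    have "s *s u \<in> V1 x" if "s \<in> max_ideal x" for s
    proof -
      have "s *s u = (s / t) *s (H *v v0)"
        using t0 by (simp add: H u_def vector_smult_assoc)
      then show ?thesis
        using that mem_max_ideal_iff[OF A t] HV1[OF v0(1)] submodule_scale[OF V1] by simp
    qed
    moreover have "\<exists>r\<in>x. as_matrix g *v v - r *s u \<in> V1 x" if "v \<in> V2 x" for v
    proof -
      have "H *v v + 0 \<in> M"
        unfolding M_def using that submodule_zero[OF N] by blast
      then obtain r w where r: "H *v v = r *s (H *v v0) + t *s w" "r \<in> x" "w \<in> V1 x"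
        unfolding \<open>N' = M\<close>[symmetric] by (auto simp: N'_def N_def)
      have "t *s (as_matrix g *v v - r *s u) = t *s w"
        using r(1) by (simp add: H u_def vector_ssub_ldistrib vector_smult_assoc mult.commute)
      then have "as_matrix g *v v - r *s u = w"
        using t0 unfolding vector_mul_lcancel by simp
      then show ?thesis
        using r by auto
    qed
    ultimately show ?thesis
      unfolding pole_along_line_def by blast
  qed
qed

text \<open>
  One line at a time: the values of \<open>p j\<close> lie in the lattice generated by the previous one and the direction \<open>u\<close> of the pole.
\<close>

lemma lattice_containing_poles:
  assumes A: "discrete_valuation_ring A" and L1: "lattice_at A L1" and "finite J"
    and "\<And>j. j \<in> J \<Longrightarrow> pole_along_line A L2 L1 (p j)"
  shows "\<exists>M. lattice_at A M \<and> L1 \<subseteq> M \<and> (\<forall>j\<in>J. \<forall>v\<in>L2. p j *v v \<in> M) \<and>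
    lattice_order A L1 \<le> lattice_order A M + int (card J)"
  using assms(3,4)
proof (induction J)
  case empty
  then show ?case
    using L1 by (intro exI[of _ L1]) simp
next
  case (insert j J)
  then obtain M where M: "lattice_at A M" "L1 \<subseteq> M" "\<forall>j\<in>J. \<forall>v\<in>L2. p j *v v \<in> M"
    "lattice_order A L1 \<le> lattice_order A M + int (card J)"
    by auto
  obtain u where u: "\<forall>s\<in>max_ideal A. s *s u \<in> L1" "\<forall>v\<in>L2. \<exists>r\<in>A. p j *v v - r *s u \<in> L1"
    using insert.prems[of j] by (auto simp: pole_along_line_def)
  have su: "s *s u \<in> M" if "s \<in> max_ideal A" for s
    using u(1) M(2) that by auto
  obtain M' where M': "lattice_at A M'" "M \<subseteq> M'" "u \<in> M'" "lattice_order A M \<le> lattice_order A M' + 1"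
    using lattice_adjoin_simple_pole[OF A M(1) su] .
  note S = lattice_submodule[OF dvr_subring[OF A] M'(1)]
  have "p j *v v \<in> M'" if v: "v \<in> L2" for v
  proof -
    obtain r where r: "r \<in> A" "p j *v v - r *s u \<in> L1"
      using u v by auto
    have "(p j *v v - r *s u) + r *s u \<in> M'"
      using r M' M(2) by (intro submodule_add[OF S] submodule_scale[OF S]) auto
    then show ?thesis
      by simp
  qed
  then show ?case
    using M M' insert.hyps by (intro exI[of _ M']) auto
qed

text \<open>
  One line at a time: if \<open>N'\<close> is the part of \<open>N\<close> on which \<open>p j\<close> is regular and \<open>w \<in> N\<close> is outside
  \<open>N'\<close>, then \<open>p j w\<close> generates the line of poles, so that \<open>N\<close> is generated by \<open>N'\<close> and \<open>w\<close>. Hence \<open>N'\<close> is at most one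
  step smaller than \<open>N\<close>, by \<open>lattice_adjoin_simple_pole\<close> applied to \<open>N'\<close> and \<open>w\<close>.
\<close>

lemma lattice_avoiding_poles:
  assumes A: "discrete_valuation_ring A" and L1: "lattice_at A L1" and L2: "lattice_at A L2"
    and "finite J" and "\<And>j. j \<in> J \<Longrightarrow> pole_along_line A L2 L1 (p j)"
  shows "\<exists>N. lattice_at A N \<and> N \<subseteq> L2 \<and> (\<forall>j\<in>J. \<forall>v\<in>N. p j *v v \<in> L1) \<and>
    lattice_order A N \<le> lattice_order A L2 + int (card J)"
  using assms(4,5)
proof (induction J)
  case empty
  then show ?case
    using L2 by (intro exI[of _ L2]) simp
next
  case (insert j J)
  then obtain N where N: "lattice_at A N" "N \<subseteq> L2" "\<forall>j\<in>J. \<forall>v\<in>N. p j *v v \<in> L1"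
    "lattice_order A N \<le> lattice_order A L2 + int (card J)"
    by auto
  obtain u where u: "\<And>s. s\<in>max_ideal A \<Longrightarrow> s *s u \<in> L1"
    "\<And>v. v\<in>L2 \<Longrightarrow> \<exists>r\<in>A. p j *v v - r *s u \<in> L1"
    using insert.prems[of j] by (auto simp: pole_along_line_def)
  note R = dvr_subring[OF A]
  note S1 = lattice_submodule[OF R L1] and SN = lattice_submodule[OF R N(1)]
  obtain t where t: "uniformizer A t"
    using A by (auto simp: discrete_valuation_ring_def)
  define N' where "N' = {v \<in> N. p j *v v \<in> L1}"
  have SN': "submodule_over A (*s) N'"
    unfolding N'_def by (rule submodule_preimage[OF SN S1])
  have small: "s *s v \<in> N'" if s: "s \<in> max_ideal A" and v: "v \<in> N" for s v
  proof -
    have sA: "s \<in> A"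
      using s max_ideal_subset by auto
    obtain r where r: "r \<in> A" "p j *v v - r *s u \<in> L1"
      using u(2)[of v] v N(2) by auto
    have "p j *v (s *s v) = s *s (p j *v v - r *s u) + r *s (s *s u)"
      by (simp add: matrix_vector_scale vector_ssub_ldistrib vector_smult_assoc mult.commute)
    also have "\<dots> \<in> L1"
      by (rule submodule_add[OF S1 submodule_scale[OF S1 sA r(2)] submodule_scale[OF S1 r(1) u(1)[OF s]]])
    finally show ?thesis
      using v sA submodule_scale[OF SN] by (simp add: N'_def)
  qed
  have N': "lattice_at A N'"
  proof (rule lattice_between[OF A SN' lattice_scaled[OF N(1) uniformizer_nonzero[OF t]] N(1)])
    show "(*s) t ` N \<subseteq> N'"
      using small uniformizer_in_max_ideal[OF t] by auto
  qed (auto simp: N'_def)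
  have "lattice_order A N' \<le> lattice_order A N + 1"
  proof (cases "N' = N")
    case False
    then obtain w where w: "w \<in> N" "p j *v w \<notin> L1"
      by (auto simp: N'_def)
    obtain M where M: "lattice_at A M" "N' \<subseteq> M" "w \<in> M" "lattice_order A N' \<le> lattice_order A M + 1"
      using lattice_adjoin_simple_pole[OF A N', of w] small w(1) by blast
    note SM = lattice_submodule[OF R M(1)]
    obtain r where r: "r \<in> A" "p j *v w - r *s u \<in> L1"
      using u(2)[of w] w N(2) by auto
    have "r \<notin> max_ideal A"
      using submodule_add[OF S1 r(2) u(1), of r] w(2) by auto
    then have r_unit: "r \<noteq> 0" "inverse r \<in> A"
      using r(1) by (auto simp: max_ideal_def)
    have "N \<subseteq> M"
    proof
      fix v assume v: "v \<in> N"
      obtain r' where r': "r' \<in> A" "p j *v v - r' *s u \<in> L1"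
        using u(2)[of v] v N(2) by auto
      define k where "k = r' * inverse r"
      have k: "k \<in> A" "k * r = r'"
        using r' r_unit by (auto simp: k_def intro: subring_mult[OF R])
      have "p j *v (v - k *s w) = (p j *v v - r' *s u) - k *s (p j *v w - r *s u)"
        by (simp add: matrix_vector_mult_diff_distrib matrix_vector_scale vector_ssub_ldistrib
            vector_smult_assoc k(2))
      also have "\<dots> \<in> L1"
        by (rule submodule_diff[OF R S1 r'(2) submodule_scale[OF S1 k(1) r(2)]])
      finally have "v - k *s w \<in> N'"
        using v w k by (auto simp: N'_def intro!: submodule_diff[OF R SN] submodule_scale[OF SN])
      then have "(v - k *s w) + k *s w \<in> M"
        using M k by (intro submodule_add[OF SM] submodule_scale[OF SM]) auto
      then show "v \<in> M"
        by simp
    qed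
    then show ?thesis
      using lattice_order_mono[OF A N(1) M(1)] M(4) by simp
  qed simp
  then show ?case
    using N N' insert.hyps by (intro exI[of _ N']) (auto simp: N'_def)
qed

text \<open>
  The stalks at a point of \<open>D\<close> of the kernel and of the image of the homomorphism to principal parts. The kernel contains
  every lattice on which all \<open>p j\<close> are regular, and the image is contained in every lattice over \<open>L\<^sub>1\<close> that contains all the
  values of the \<open>p j\<close>.
\<close>

lemma sum_of_poles_local:
  fixes P :: "'K::field^'b::finite^'a::finite"
  assumes A: "discrete_valuation_ring A" and L1: "lattice_at A L1" and L2: "lattice_at A L2"
    and J: "finite J" "\<And>j. j \<in> J \<Longrightarrow> pole_along_line A L2 L1 (p j)" "\<And>j. j \<in> J \<Longrightarrow> c j \<in> A"
    and P: "\<And>v. v \<in> L2 \<Longrightarrow> P *v v - (\<Sum>j\<in>J. c j *s (p j *v v)) \<in> L1"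
  shows "lattice_at A {v \<in> L2. P *v v \<in> L1}"
    and "lattice_order A {v \<in> L2. P *v v \<in> L1} \<le> lattice_order A L2 + int (card J)"
    and "lattice_at A {P *v v + w |v w. v \<in> L2 \<and> w \<in> L1}"
    and "quotient_length A (*s) L1 {P *v v + w |v w. v \<in> L2 \<and> w \<in> L1} \<le> enat (card J)"
    and "\<And>s v. s \<in> max_ideal A \<Longrightarrow> v \<in> {P *v v + w |v w. v \<in> L2 \<and> w \<in> L1} \<Longrightarrow> s *s v \<in> L1"
proof -
  let ?G = "{v \<in> L2. P *v v \<in> L1}" and ?T = "{P *v v + w |v w. v \<in> L2 \<and> w \<in> L1}"
  note R = dvr_subring[OF A]
  note S1 = lattice_submodule[OF R L1] and S2 = lattice_submodule[OF R L2]
  have P_mem: "P *v v \<in> M"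
    if "submodule_over A (*s) M" "L1 \<subseteq> M" "v \<in> L2" "\<And>j. j \<in> J \<Longrightarrow> p j *v v \<in> M" for M v
  proof -
    have "(P *v v - (\<Sum>j\<in>J. c j *s (p j *v v))) + (\<Sum>j\<in>J. c j *s (p j *v v)) \<in> M"
      using P[OF that(3)] that J(3)
      by (intro submodule_add[OF that(1)] submodule_sum[OF that(1)] submodule_scale[OF that(1)]) auto
    then show ?thesis
      by simp
  qed
  obtain N where N: "lattice_at A N" "N \<subseteq> L2" "\<forall>j\<in>J. \<forall>v\<in>N. p j *v v \<in> L1"
    "lattice_order A N \<le> lattice_order A L2 + int (card J)"
    using lattice_avoiding_poles[OF A L1 L2 J(1), of p] J(2) by blast
  obtain M where M: "lattice_at A M" "L1 \<subseteq> M" "\<forall>j\<in>J. \<forall>v\<in>L2. p j *v v \<in> M"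
    "lattice_order A L1 \<le> lattice_order A M + int (card J)"
    using lattice_containing_poles[OF A L1 J(1), of L2 p] J(2) by blast
  note SM = lattice_submodule[OF R M(1)]
  have NG: "N \<subseteq> ?G"
    using N P_mem[OF S1] by auto
  show G: "lattice_at A ?G"
    by (rule lattice_between[OF A submodule_preimage[OF S2 S1] N(1) L2 NG]) auto
  show "lattice_order A ?G \<le> lattice_order A L2 + int (card J)"
    using lattice_order_mono[OF A N(1) G NG] N(4) by simp
  have "P *v 0 + w \<in> ?T" if "w \<in> L1" for w
    using submodule_zero[OF S2] that by blast
  then have LT: "L1 \<subseteq> ?T"
    by auto
  have TM: "?T \<subseteq> M"
    using P_mem[OF SM M(2)] M(2,3) by (auto intro!: submodule_add[OF SM])
  show T: "lattice_at A ?T"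
    by (rule lattice_between[OF A submodule_image_plus[OF S2 S1] L1 M(1) LT TM])
  have "lattice_order A L1 - lattice_order A ?T \<le> int (card J)"
    using lattice_order_mono[OF A T M(1) TM] M(4) by simp
  then have "enat (nat (lattice_order A L1 - lattice_order A ?T)) \<le> enat (card J)"
    by simp
  then show "quotient_length A (*s) L1 ?T \<le> enat (card J)"
    using quotient_length_le_lattice_order[OF A L1 T] by (rule order_trans[rotated])
  show "s *s v \<in> L1" if s: "s \<in> max_ideal A" and v: "v \<in> ?T" for s v
  proof -
    have sA: "s \<in> A"
      using s max_ideal_subset by auto
    obtain v' w where v': "v = P *v v' + w" "v' \<in> L2" "w \<in> L1"
      using v by auto
    have "s *s (p j *v v') \<in> L1" if j: "j \<in> J" for j
    proof -
      obtain u where "\<forall>s\<in>max_ideal A. s *s u \<in> L1" "\<forall>v\<in>L2. \<exists>r\<in>A. p j *v v - r *s u \<in> L1"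
        using J(2)[OF j] unfolding pole_along_line_def by blast
      then obtain r where u: "s *s u \<in> L1" "r \<in> A" "p j *v v' - r *s u \<in> L1"
        using s v'(2) by blast
      have "s *s (p j *v v' - r *s u) + r *s (s *s u) \<in> L1"
        by (rule submodule_add[OF S1 submodule_scale[OF S1 sA u(3)] submodule_scale[OF S1 u(2,1)]])
      then show ?thesis
        by (simp add: vector_ssub_ldistrib vector_smult_assoc mult.commute)
    qed
    then have "c j *s (s *s (p j *v v')) \<in> L1" if "j \<in> J" for j
      by (rule submodule_scale[OF S1 J(3)[OF that]]) (rule that)
    then have "s *s (P *v v' - (\<Sum>j\<in>J. c j *s (p j *v v'))) + (\<Sum>j\<in>J. c j *s (s *s (p j *v v'))) + s *s w \<in> L1"
      by (intro submodule_add[OF S1] submodule_sum[OF S1]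
          submodule_scale[OF S1 sA P[OF v'(2)]] submodule_scale[OF S1 sA v'(3)])
    moreover have "(\<Sum>j\<in>J. c j *s (s *s (p j *v v'))) = s *s (\<Sum>j\<in>J. c j *s (p j *v v'))"
      by (simp add: vec.scale_sum_right vector_smult_assoc mult.commute)
    ultimately show ?thesis
      by (simp add: v'(1) vec.scale_right_distrib vector_ssub_ldistrib)
  qed
qed

section \<open>Degrees of points and bundles\<close>

text \<open>
  A \<open>k\<close>-subspace of the local ring that is strictly above the maximal ideal contains a function with nonzero value
  in \<open>k\<close>, hence all constants, hence the whole local ring. So a chain has at most one step.
\<close>

lemma point_degree_rational:
  assumes X: "smooth_projective_curve \<iota> X" and x: "rational_point \<iota> X x"
  shows "point_degree \<iota> x \<le> 1"
proof -
  note dx = rational_point_dvr[OF X x]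
  note R = dvr_subring[OF dx]
  have emb: "field_embedding \<iota>"
    using X by (simp add: smooth_projective_curve_def)
  have "quotient_length (range \<iota>) (*) (max_ideal x) x \<le> enat 1"
  proof (rule quotient_length_leI)
    fix n C
    assume ends: "C 0 = max_ideal x" "C n = x"
      and C: "\<forall>i\<le>n. submodule_over (range \<iota>) (*) (C i)" "\<forall>i<n. C i \<subset> C (Suc i)"
      and mono: "\<forall>i j. i \<le> j \<longrightarrow> j \<le> n \<longrightarrow> C i \<subseteq> C j"
    show "n \<le> 1"
    proof (rule ccontr)
      assume "\<not> n \<le> 1"
      then have n: "1 < n"
        by simp
      have C1: "submodule_over (range \<iota>) (*) (C 1)"
        using C(1) n by simp
      have step01: "C 0 \<subset> C 1" and step12: "C 1 \<subset> C 2"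
        using C(2) n by (auto simp: numeral_2_eq_2)
      then obtain f where f: "f \<in> C 1" "f \<notin> max_ideal x"
        using ends by auto
      have "f \<in> x"
        using f mono[rule_format, of 1 n] n ends by auto
      then obtain c where c: "f - \<iota> c \<in> max_ideal x"
        using x by (auto simp: rational_point_def)
      then have "\<iota> c \<noteq> 0"
        using f by auto
      have "f - \<iota> c \<in> C 1"
        using c step01 ends by auto
      then have "\<iota> (- 1) * (f - \<iota> c) + f \<in> C 1"
        using submodule_add[OF C1 submodule_scale[OF C1] f(1)] by blast
      moreover have "\<iota> (- 1) = - 1"
        using field_embedding_diff[OF emb, of 0 1] field_embedding_zero[OF emb] emb
        by (simp add: field_embedding_def)
      ultimately have "\<iota> c \<in> C 1"
        by simp
      then have "\<iota> (inverse c) * \<iota> c \<in> C 1"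
        by (intro submodule_scale[OF C1]) auto
      then have one: "1 \<in> C 1"
        using \<open>\<iota> c \<noteq> 0\<close> by (simp add: field_embedding_inverse[OF emb])
      have "x \<subseteq> C 1"
      proof
        fix g assume "g \<in> x"
        then obtain d where d: "g - \<iota> d \<in> max_ideal x"
          using x by (auto simp: rational_point_def)
        then have "g - \<iota> d \<in> C 1"
          using step01 ends by auto
        moreover have "\<iota> d * 1 \<in> C 1"
          using one by (intro submodule_scale[OF C1]) auto
        ultimately have "(g - \<iota> d) + \<iota> d * 1 \<in> C 1"
          by (rule submodule_add[OF C1])
        then show "g \<in> C 1"
          by simp
      qed
      moreover have "C 2 \<subseteq> x"
        using mono[rule_format, of 2 n] n ends by auto
      ultimately show False
        using step12 by auto
    qed
  qed
  then show ?thesis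
    unfolding point_degree_def by (cases "quotient_length (range \<iota>) (*) (max_ideal x) x") auto
qed

text \<open>
  The degree is a sum over the points at which the local order does not vanish. If there are infinitely many of
  them for \<open>F\<close>, the same holds for \<open>G\<close>, and both sums are zero by convention; otherwise the two sums are
  compared term by term.
\<close>

lemma bundle_degree_modify:
  fixes F G :: "('K::field, 'n::finite) lattice_sheaf"
  assumes Y: "finite Y" "Y \<subseteq> X - {UNIV}" "\<And>y. y \<in> Y \<Longrightarrow> point_degree \<iota> y \<le> 1"
    and outside: "\<And>z. z \<in> X \<Longrightarrow> z \<notin> Y \<Longrightarrow> G z = F z"
    and inside: "\<And>y. y \<in> Y \<Longrightarrow> lattice_order y (G y) \<le> lattice_order y (F y) + int (m y)"
  shows "bundle_degree \<iota> X G \<ge> bundle_degree \<iota> X F - (\<Sum>y\<in>Y. int (m y))"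
proof -
  define supp where "supp V = {z \<in> X - {UNIV}. lattice_order z (V z) \<noteq> 0}" for V :: "('K, 'n) lattice_sheaf"
  define local_deg where "local_deg V z = int (point_degree \<iota> z) * lattice_order z (V z)"
    for V :: "('K, 'n) lattice_sheaf" and z
  have deg: "bundle_degree \<iota> X V = - (\<Sum>z\<in>supp V. local_deg V z)" for V :: "('K, 'n) lattice_sheaf"
    by (simp add: bundle_degree_def supp_def local_deg_def frame_order_lattice_order)
  have subs: "supp G \<subseteq> supp F \<union> Y" "supp F \<subseteq> supp G \<union> Y"
    using outside by (auto simp: supp_def)
  show ?thesis
  proof (cases "finite (supp F)")
    case False
    then have "infinite (supp G)"
      using subs(2) Y(1) finite_subset by blast
    with False show ?thesis
      by (simp add: deg sum_nonneg)
  next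
    case True
    define S where "S = supp F \<union> Y"
    have S: "finite S" "Y \<subseteq> S" "S \<subseteq> X - {UNIV}"
      using True Y by (auto simp: S_def supp_def)
    have extend: "(\<Sum>z\<in>supp V. local_deg V z) = (\<Sum>z\<in>S. local_deg V z)"
      if "supp V \<subseteq> S" for V :: "('K, 'n) lattice_sheaf"
      using that S by (intro sum.mono_neutral_left) (auto simp: supp_def local_deg_def)
    have "local_deg G z - local_deg F z \<le> (if z \<in> Y then int (m z) else 0)" if "z \<in> S" for z
    proof (cases "z \<in> Y")
      case True
      have "int (point_degree \<iota> z) * (lattice_order z (G z) - lattice_order z (F z))
          \<le> int (point_degree \<iota> z) * int (m z)"
        using inside[OF True] by (intro mult_left_mono) auto
      also have "\<dots> \<le> 1 * int (m z)"
        using Y(3)[OF True] by (intro mult_right_mono) auto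
      finally show ?thesis
        using True by (simp add: local_deg_def algebra_simps)
    next
      case False
      then show ?thesis
        using outside[of z] that S by (auto simp: local_deg_def)
    qed
    then have "(\<Sum>z\<in>S. local_deg G z - local_deg F z) \<le> (\<Sum>z\<in>S. if z \<in> Y then int (m z) else 0)"
      by (rule sum_mono)
    also have "\<dots> = (\<Sum>y\<in>Y. int (m y))"
      using S by (simp add: sum.If_cases Int_absorb1)
    finally show ?thesis
      using subs by (simp add: deg extend S_def sum_subtractf)
  qed
qed

section \<open>The quotient of an extension by the graph of a rational splitting\<close>

lemma zariski_open_subset: "openin (zariski X) U \<Longrightarrow> U \<subseteq> X"
  using openin_subset[of "zariski X" U]
  unfolding zariski_def topology_generated_by_topspace by auto

text \<open>
  Every vector is uniquely of the form \<open>\<alpha> u + \<sigma> v\<close>, and \<open>T\<close> is the image of \<open>W\<close> under the projection to \<open>u\<close>. A frame of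
  \<open>T\<close> near \<open>z\<close> lifts to sections of \<open>W\<close> at \<open>z\<close>, which remain regular on a neighbourhood of \<open>z\<close>. The coordinates of
  a section of \<open>W\<close> modulo the image of \<open>\<sigma>\<close> are those of its projection in the frame of \<open>T\<close>.
\<close>

lemma saturated_quotient_locally_free:
  fixes \<alpha> :: "'K::field^'a::finite^'m::finite" and \<beta> :: "'K^'m^'b::finite" and \<sigma> :: "'K^'b^'m"
  assumes X: "smooth_projective_curve \<iota> X" and W: "vector_bundle X W" and T: "vector_bundle X T"
    and \<alpha>: "inj ((*v) \<alpha>)" and \<beta>\<alpha>: "\<And>u. \<beta> *v (\<alpha> *v u) = 0"
    and exact: "\<And>w. \<beta> *v w = 0 \<Longrightarrow> w \<in> range ((*v) \<alpha>)"
    and \<sigma>: "\<beta> ** \<sigma> = mat 1"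
    and T_eq: "\<And>y. y \<in> X \<Longrightarrow> T y = {u. \<exists>v. \<alpha> *v u + \<sigma> *v v \<in> W y}"
  shows "locally_free_quotient X W (\<lambda>y. (*v) \<sigma> ` {v. \<sigma> *v v \<in> W y})"
  unfolding locally_free_quotient_def
proof
  fix z assume z: "z \<in> X"
  have \<beta>\<sigma>: "\<beta> *v (\<sigma> *v v) = v" for v
    by (simp add: matrix_vector_mul_assoc \<sigma>)
  have decompose: "\<exists>u v. w = \<alpha> *v u + \<sigma> *v v" for w
  proof -
    have "\<beta> *v (w - \<sigma> *v (\<beta> *v w)) = 0"
      by (simp add: matrix_vector_mult_diff_distrib \<beta>\<sigma>)
    then obtain u where "w - \<sigma> *v (\<beta> *v w) = \<alpha> *v u"
      using exact by blast
    then have "w = \<alpha> *v u + \<sigma> *v (\<beta> *v w)"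
      by (simp add: diff_eq_eq)
    then show ?thesis
      by blast
  qed
  have unique: "u = u'" if "\<alpha> *v u + \<sigma> *v v = \<alpha> *v u' + \<sigma> *v v'" for u u' v v'
  proof -
    have "v = v'"
      using arg_cong[OF that, of "(*v) \<beta>"] by (simp add: matrix_vector_right_distrib \<beta>\<alpha> \<beta>\<sigma>)
    then show ?thesis
      using that \<alpha> by (simp add: inj_eq)
  qed
  obtain U0 B where U0: "openin (zariski X) U0" "z \<in> U0" "det B \<noteq> 0" "\<forall>y\<in>U0. T y = frame_span y B"
    using T z unfolding vector_bundle_def by blast
  obtain U1 B1 where U1: "openin (zariski X) U1" "z \<in> U1" "det B1 \<noteq> 0" "\<forall>y\<in>U1. W y = frame_span y B1"
    using W z unfolding vector_bundle_def by blast
  have "\<exists>v. \<alpha> *v column j B + \<sigma> *v v \<in> W z" for j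
  proof -
    have "column j B \<in> T z"
      using U0 column_in_frame_span[OF curve_point_subring[OF X z]] by blast
    then show ?thesis
      using T_eq[OF z] by blast
  qed
  then obtain l where l: "\<And>j. \<alpha> *v column j B + \<sigma> *v l j \<in> W z"
    by metis
  define c where "c j = \<alpha> *v column j B + \<sigma> *v l j" for j
  have "\<exists>d. c j = B1 *v d \<and> (\<forall>i. d $ i \<in> z)" for j
    using l[of j] U1(2,4) by (auto simp: c_def frame_span_def)
  then obtain d where d: "\<And>j. c j = B1 *v d j" "\<And>i j. d j $ i \<in> z"
    by metis
  \<comment> \<open>where the coordinates of the lifts in a frame of \<open>W\<close> are regular, so are the lifts\<close>
  define F where "F = range (\<lambda>(i, j). d j $ i)"
  have F: "finite F" "F \<subseteq> z"
    using d(2) by (auto simp: F_def)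
  define U where "U = U0 \<inter> U1 \<inter> {y \<in> X. F \<subseteq> y}"
  have "openin (zariski X) U"
    unfolding U_def
    by (intro openin_Int U0(1) U1(1) openin_zariski_finite_subset[OF curve_point_subring[OF X] F(1)])
  moreover have "z \<in> U"
    using U0(2) U1(2) z F(2) by (simp add: U_def)
  moreover have "finite (range c)"
    by simp
  moreover have "range c \<subseteq> W y \<and>
      (\<forall>w\<in>W y. \<exists>!a. a \<in> range c \<rightarrow>\<^sub>E y \<and> w - (\<Sum>k\<in>range c. a k *s k) \<in> (*v) \<sigma> ` {v. \<sigma> *v v \<in> W y})"
    if y: "y \<in> U" for y
  proof (intro conjI ballI)
    have yX: "y \<in> X"
      using y by (simp add: U_def)
    note R = curve_point_subring[OF X yX]
    have Ty: "T y = frame_span y B" and Wy: "W y = frame_span y B1"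
      using y U0(4) U1(4) by (auto simp: U_def)
    have SW: "submodule_over y (*s) (W y)"
      unfolding Wy by (rule submodule_frame_span[OF R])
    have "d j $ i \<in> y" for i j
      using y unfolding U_def F_def by fast
    then have cW: "c j \<in> W y" for j
      unfolding Wy frame_span_def using d(1) by blast
    then show "range c \<subseteq> W y"
      by auto
    obtain B' where B': "B' ** B = mat 1"
      using frame_inverse[OF U0(3)] by metis
    have B_inj: "a = a'" if "B *v a = B *v a'" for a a'
      using arg_cong[OF that, of "(*v) B'"] by (simp add: matrix_vector_mul_assoc B')
    have inj_c: "inj c"
    proof
      fix i j assume "c i = c j"
      then have "column i B = column j B"
        unfolding c_def by (rule unique)
      then have "B *v axis i 1 = B *v (axis j 1 :: 'K^'a)"
        by (simp only: matrix_vector_axis)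
      then have "axis i 1 = (axis j 1 :: 'K^'a)"
        by (rule B_inj)
      then show "i = j"
        by (simp add: axis_eq_axis)
    qed
    fix w assume w: "w \<in> W y"
    obtain u v where uv: "w = \<alpha> *v u + \<sigma> *v v"
      using decompose by blast
    then have "u \<in> T y"
      using w T_eq[OF yX] by blast
    then obtain e where e: "u = B *v e" "\<forall>i. e $ i \<in> y"
      unfolding Ty frame_span_def by blast
    have combination: "(\<Sum>j\<in>UNIV. f $ j *s c j) = \<alpha> *v (B *v f) + \<sigma> *v (\<Sum>j\<in>UNIV. f $ j *s l j)"
      for f :: "'K^'a"
      by (simp add: c_def vec.scale_right_distrib sum.distrib matrix_mult_sum[of B f] vec.sum
          matrix_vector_scale)
    have sum_C: "(\<Sum>k\<in>range c. a k *s k) = (\<Sum>j\<in>UNIV. (\<chi> j. a (c j)) $ j *s c j)" for a :: "'K^'m \<Rightarrow> 'K"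
      by (simp add: sum.reindex[OF inj_c])
    have criterion: "w - (\<Sum>j\<in>UNIV. f $ j *s c j) \<in> (*v) \<sigma> ` {v. \<sigma> *v v \<in> W y} \<longleftrightarrow> f = e"
      if f: "\<forall>i. f $ i \<in> y \<or> f = e" for f
    proof
      assume "w - (\<Sum>j\<in>UNIV. f $ j *s c j) \<in> (*v) \<sigma> ` {v. \<sigma> *v v \<in> W y}"
      then obtain v' where "w - (\<Sum>j\<in>UNIV. f $ j *s c j) = \<sigma> *v v'"
        by blast
      then have "\<alpha> *v u + \<sigma> *v v = \<alpha> *v (B *v f) + \<sigma> *v ((\<Sum>j\<in>UNIV. f $ j *s l j) + v')"
        by (simp add: uv combination matrix_vector_right_distrib diff_eq_eq algebra_simps)
      then show "f = e"
        using unique B_inj e(1) by metis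
    next
      assume "f = e"
      define v' where "v' = v - (\<Sum>j\<in>UNIV. e $ j *s l j)"
      have "w - (\<Sum>j\<in>UNIV. f $ j *s c j) = \<sigma> *v v'"
        by (simp add: \<open>f = e\<close> uv combination e(1)[symmetric] v'_def matrix_vector_mult_diff_distrib)
      moreover have "w - (\<Sum>j\<in>UNIV. f $ j *s c j) \<in> W y"
        using w cW e(2) \<open>f = e\<close>
        by (intro submodule_diff[OF R SW] submodule_sum[OF SW] submodule_scale[OF SW]) auto
      ultimately show "w - (\<Sum>j\<in>UNIV. f $ j *s c j) \<in> (*v) \<sigma> ` {v. \<sigma> *v v \<in> W y}"
        by simp
    qed
    show "\<exists>!a. a \<in> range c \<rightarrow>\<^sub>E y \<and> w - (\<Sum>k\<in>range c. a k *s k) \<in> (*v) \<sigma> ` {v. \<sigma> *v v \<in> W y}"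
    proof (rule ex1I[of _ "\<lambda>k\<in>range c. e $ inv c k"])
      have "(\<lambda>k\<in>range c. e $ inv c k) (c j) = e $ j" for j
        using inj_c by (subst restrict_apply') auto
      then have "(\<chi> j. (\<lambda>k\<in>range c. e $ inv c k) (c j)) = e"
        unfolding vec_eq_iff vec_lambda_beta by blast
      then show "(\<lambda>k\<in>range c. e $ inv c k) \<in> range c \<rightarrow>\<^sub>E y \<and>
          w - (\<Sum>k\<in>range c. (\<lambda>k\<in>range c. e $ inv c k) k *s k) \<in> (*v) \<sigma> ` {v. \<sigma> *v v \<in> W y}"
        unfolding sum_C using criterion[of e] e(2) by auto
    next
      fix a assume a: "a \<in> range c \<rightarrow>\<^sub>E y \<and>
          w - (\<Sum>k\<in>range c. a k *s k) \<in> (*v) \<sigma> ` {v. \<sigma> *v v \<in> W y}"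
      then have "(\<chi> j. a (c j)) = e"
        using criterion[of "\<chi> j. a (c j)"] unfolding sum_C by (auto simp: PiE_iff)
      then have "a (c j) = e $ j" for j
        by (simp add: vec_eq_iff)
      then show "a = (\<lambda>k\<in>range c. e $ inv c k)"
        using a inj_c by (intro extensionalityI[of _ "range c"]) (auto simp: PiE_iff)
    qed
  qed
  ultimately show "\<exists>U C. openin (zariski X) U \<and> z \<in> U \<and> finite C \<and> (\<forall>y\<in>U. C \<subseteq> W y \<and>
      (\<forall>w\<in>W y. \<exists>!a. a \<in> C \<rightarrow>\<^sub>E y \<and> w - (\<Sum>k\<in>C. a k *s k) \<in> (*v) \<sigma> ` {v. \<sigma> *v v \<in> W y}))"
    by (intro exI[of _ U] exI[of _ "range c"]) simp
qed

section \<open>Errors of bounded weight\<close>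

lemma H1_class_cong:
  assumes V: "\<And>z. z \<in> X \<Longrightarrow> submodule_over z (*s) (V z)" and X: "\<And>z. z \<in> X \<Longrightarrow> subring_of_field z"
    and ab: "\<And>z. z \<in> X \<Longrightarrow> a z - b z - f \<in> V z"
  shows "H1_class X V a = H1_class X V b"
proof -
  have "H1_class X V a' \<subseteq> H1_class X V b'" if ab': "\<And>z. z \<in> X \<Longrightarrow> a' z - b' z - f' \<in> V z" for a' b' f'
  proof
    fix q assume "q \<in> H1_class X V a'"
    then obtain g where q: "q \<in> prin_reps X V" "\<And>z. z \<in> X \<Longrightarrow> q z - (a' z + g) \<in> V z"
      by (auto simp: H1_class_def prin_eq_def)
    have "q z - (b' z + (g + f')) \<in> V z" if "z \<in> X" for z
      using submodule_add[OF V q(2) ab', OF that that that] by (simp add: algebra_simps)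
    then show "q \<in> H1_class X V b'"
      using q(1) unfolding H1_class_def prin_eq_def by blast
  qed
  moreover have "b z - a z - (- f) \<in> V z" if "z \<in> X" for z
    using submodule_diff[OF X V submodule_zero[OF V] ab, OF that that that that]
    by (simp add: algebra_simps)
  ultimately show ?thesis
    using ab by (metis subset_antisym)
qed

lemma locally_free_quotient_cong:
  assumes "locally_free_quotient X V N" and eq: "\<And>z. z \<in> X \<Longrightarrow> N z = N' z"
  shows "locally_free_quotient X V N'"
  unfolding locally_free_quotient_def
proof
  fix z assume "z \<in> X"
  from assms(1)[unfolded locally_free_quotient_def, THEN bspec, OF this]
  obtain U C where U: "openin (zariski X) U" "z \<in> U" "finite C"
    and C: "\<forall>y\<in>U. C \<subseteq> V y \<and> (\<forall>v\<in>V y. \<exists>!a. a \<in> C \<rightarrow>\<^sub>E y \<and> v - (\<Sum>c\<in>C. a c *s c) \<in> N y)"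
    by (elim exE conjE)
  have "N y = N' y" if "y \<in> U" for y
    using eq that zariski_open_subset[OF U(1)] by blast
  then have "\<forall>y\<in>U. C \<subseteq> V y \<and> (\<forall>v\<in>V y. \<exists>!a. a \<in> C \<rightarrow>\<^sub>E y \<and> v - (\<Sum>c\<in>C. a c *s c) \<in> N' y)"
    using C by simp
  then show "\<exists>U C. openin (zariski X) U \<and> z \<in> U \<and> finite C \<and>
      (\<forall>y\<in>U. C \<subseteq> V y \<and> (\<forall>v\<in>V y. \<exists>!a. a \<in> C \<rightarrow>\<^sub>E y \<and> v - (\<Sum>c\<in>C. a c *s c) \<in> N' y))"
    by (intro exI[of _ U] exI[of _ C] conjI U)
qed

lemma as_matrix_diff_vector:
  fixes g h :: "'K::field^('a::finite \<times> 'b::finite)"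
  shows "as_matrix (g - h) *v v = as_matrix g *v v - as_matrix h *v v"
  by (simp add: as_matrix_def vec_eq_iff matrix_vector_mult_def sum_subtractf left_diff_distrib)

lemma weight_eq_sum: "weight e = (\<Sum>i\<in>UNIV. card {j. e $ i $ j \<noteq> 0})"
proof -
  have "{(i, j). e $ i $ j \<noteq> 0} = (SIGMA i:UNIV. {j. e $ i $ j \<noteq> 0})"
    by auto
  then show ?thesis
    by (simp add: weight_def)
qed

theorem theorem5p1:
  fixes \<iota> :: "'k::{field,finite} \<Rightarrow> 'K::field"
    and X :: "'K set set"
    and x :: "'s::finite \<Rightarrow> 'K set"
    and D :: "'K set \<Rightarrow> int"
    and F1 :: "('K, 'n1::finite) lattice_sheaf"
    and F2 :: "('K, 'n2::finite) lattice_sheaf"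
    and Hstar E :: "('K, 'n1 \<times> 'n2) lattice_sheaf"
    and p :: "'s \<Rightarrow> 'r::finite \<Rightarrow> 'K set \<Rightarrow> 'K^('n1 \<times> 'n2)"
    and cw e y :: "'k^'r^'s"
    and W :: "('K, 'm::finite) lattice_sheaf"
    and \<alpha> :: "'K^'n1^'m" and \<beta> :: "'K^'m^'n2"
    and h :: nat
  assumes curve: "smooth_projective_curve \<iota> X" "geometrically_irreducible \<iota>"
    and points: "\<And>i. rational_point \<iota> X (x i)" "inj x"
    and D: "D = point_sum x"
    and bundles: "vector_bundle X F1" "vector_bundle X F2"
    and Hstar: "Hstar = hom_bundle F2 F1"
    and E: "E = twist D Hstar"
    and very_ample: "O1_very_ample \<iota> X E"
    and h1: "H1 X E = {H1_class X E (\<lambda>_. 0)}"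
    and h0: "H0 X (twist (\<lambda>z. - D z) E) = {0}"
    and rank: "CARD('r) = CARD('n1) * CARD('n2)"
    and basis: "principal_part_basis \<iota> X D Hstar p"
    and support: "\<And>i j z. z \<in> X \<Longrightarrow> z \<noteq> x i \<Longrightarrow> p i j z \<in> Hstar z"
    and rank_one: "\<And>i j t. uniformizer (x i) t \<Longrightarrow> fibre_rank (x i) F2 F1 (t *s p i j (x i)) = 1"
    and codeword: "cw \<in> code \<iota> X D Hstar p"
    and received: "y = cw + e"
    and extension: "is_extension X F1 W F2 \<alpha> \<beta>"
    and ext_class: "extension_class X F1 W F2 \<alpha> \<beta> = syndrome \<iota> X Hstar p y"
  shows "syndrome \<iota> X Hstar p y = syndrome \<iota> X Hstar p e \<and>
    (weight e \<le> h \<longrightarrow>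
      (\<exists>G T. elementary_transformation X G F2 \<and>
             simple_pole_subsheaf X D F1 T \<and>
             skyscraper_length X F1 T \<le> enat h \<and>
             skyscraper_quotient_sequence X G F2 F1 T \<and>
             lifts_to_subbundle X G W \<beta> \<and>
             bundle_degree \<iota> X G \<ge> bundle_degree \<iota> X F2 - int h))"
proof (intro conjI impI)
  have emb: "field_embedding \<iota>"
    using curve(1) by (simp add: smooth_projective_curve_def)
  have R: "subring_of_field z" if "z \<in> X" for z
    using curve_point_subring[OF curve(1) that] .
  have const: "\<iota> c \<in> z" if "z \<in> X" for c z
    using curve_point_contains_constants[OF curve(1) that] .
  have L1: "lattice_at z (F1 z)" and L2: "lattice_at z (F2 z)" and LW: "lattice_at z (W z)"
    if "z \<in> X" for z
    using that bundles extension by (auto simp: is_extension_def intro: vector_bundle_stalk)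
  have S1: "submodule_over z (*s) (F1 z)" and S2: "submodule_over z (*s) (F2 z)"
    and SW: "submodule_over z (*s) (W z)" if "z \<in> X" for z
    using lattice_submodule[OF R[OF that]] L1[OF that] L2[OF that] LW[OF that] by blast+
  have SH: "submodule_over z (*s) (Hstar z)" if "z \<in> X" for z
    unfolding Hstar using submodule_hom_bundle[of z F1 z F2, OF S1[OF that]] .
  have xX: "x i \<in> X" and x_closed: "x i \<noteq> UNIV" and dvr: "discrete_valuation_ring (x i)" for i
    using points(1)[of i] rational_point_dvr[OF curve(1)] by (auto simp: rational_point_def)

  have word_add: "word_prin \<iota> p y z = word_prin \<iota> p cw z + word_prin \<iota> p e z" for z
    using emb by (simp add: word_prin_def received field_embedding_def vec.scale_left_distrib sum.distrib)
  obtain f where f: "\<And>z. z \<in> X \<Longrightarrow> f - word_prin \<iota> p cw z \<in> Hstar z"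
    using codeword by (auto simp: code_def prin_eq_def)
  have words: "word_prin \<iota> p y z - word_prin \<iota> p e z - f \<in> Hstar z" if "z \<in> X" for z
    using submodule_diff[OF R SH submodule_zero[OF SH] f, OF that that that that]
    by (simp add: word_add)
  show syndromes: "syndrome \<iota> X Hstar p y = syndrome \<iota> X Hstar p e"
    unfolding syndrome_def by (rule H1_class_cong[where f = f]) (use SH R words in simp_all)

  assume weight_e: "weight e \<le> h"
  define a where "a = word_prin \<iota> p e"
  define P where "P z = as_matrix (a z)" for z
  have a_hom: "a z \<in> Hstar z" if "z \<in> X" "z \<notin> range x" for z
    unfolding a_def word_prin_def
    using that by (intro submodule_sum[OF SH] submodule_scale[OF SH] const support) auto
  \<comment> \<open>the word \<open>e\<close> itself represents its syndrome, hence the class of the extension\<close>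
  have "finite {z \<in> X. a z \<notin> Hstar z}"
    by (rule finite_subset[of _ "range x"]) (use a_hom in auto)
  moreover have "prin_eq X Hstar a (\<lambda>z. a z + 0)"
    by (simp add: prin_eq_def submodule_zero[OF SH])
  ultimately have "a \<in> syndrome \<iota> X Hstar p e"
    unfolding syndrome_def H1_class_def prin_reps_def a_def by blast
  then have "a \<in> extension_class X F1 W F2 \<alpha> \<beta>"
    using ext_class syndromes by simp
  then obtain \<sigma> :: "'K^'n2^'m" where \<sigma>: "\<beta> ** \<sigma> = mat 1"
    and \<sigma>W: "\<And>z v. z \<in> X \<Longrightarrow> v \<in> F2 z \<Longrightarrow> \<sigma> *v v - \<alpha> *v (P z *v v) \<in> W z"
    unfolding extension_class_def P_def by blast
  have \<beta>\<sigma>: "\<beta> *v (\<sigma> *v v) = v" for v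
    by (simp add: matrix_vector_mul_assoc \<sigma>)
  have ext: "inj_on ((*v) \<alpha>) (F1 z)" "(*v) \<alpha> ` F1 z = {w \<in> W z. \<beta> *v w = 0}" "(*v) \<beta> ` W z = F2 z"
    if "z \<in> X" for z
    using extension that by (auto simp: is_extension_def)

  \<comment> \<open>at the generic point the exactness of the extension becomes a statement about rational sections\<close>
  have generic: "UNIV \<in> X"
    using curve(1) by (simp add: smooth_projective_curve_def)
  have "F1 UNIV = UNIV" "W UNIV = UNIV"
    using L1[OF generic] LW[OF generic] by (auto simp: lattice_at_def frame_span_UNIV)
  then have \<alpha>: "inj ((*v) \<alpha>)" and range_\<alpha>: "range ((*v) \<alpha>) = {w. \<beta> *v w = 0}"
    using ext(1,2)[OF generic] by auto
  have \<beta>\<alpha>: "\<beta> *v (\<alpha> *v u) = 0" for u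
    using range_\<alpha> by blast
  have \<alpha>W: "\<alpha> *v u \<in> W z \<longleftrightarrow> u \<in> F1 z" if z: "z \<in> X" for u z
  proof
    assume "\<alpha> *v u \<in> W z"
    then have "\<alpha> *v u \<in> (*v) \<alpha> ` F1 z"
      using ext(2)[OF z] \<beta>\<alpha> by simp
    then show "u \<in> F1 z"
      using \<alpha> by (auto simp: inj_eq)
  qed (use ext(2)[OF z] in auto)

  define G where "G z = {v \<in> F2 z. P z *v v \<in> F1 z}" for z
  define T where "T z = {P z *v v + w |v w. v \<in> F2 z \<and> w \<in> F1 z}" for z
  have G_eq: "G z = {v. \<sigma> *v v \<in> W z}" if z: "z \<in> X" for z
  proof (intro set_eqI iffI CollectI)
    fix v assume "v \<in> G z"
    then have "(\<sigma> *v v - \<alpha> *v (P z *v v)) + \<alpha> *v (P z *v v) \<in> W z"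
      using \<sigma>W[OF z] \<alpha>W[OF z] by (intro submodule_add[OF SW[OF z]]) (auto simp: G_def)
    then show "\<sigma> *v v \<in> W z"
      by simp
  next
    fix v assume v: "v \<in> {v. \<sigma> *v v \<in> W z}"
    then have "\<beta> *v (\<sigma> *v v) \<in> F2 z"
      using ext(3)[OF z] by blast
    then have vF: "v \<in> F2 z"
      by (simp add: \<beta>\<sigma>)
    have "\<sigma> *v v - (\<sigma> *v v - \<alpha> *v (P z *v v)) \<in> W z"
      using v by (intro submodule_diff[OF R[OF z] SW[OF z] _ \<sigma>W[OF z vF]]) simp
    then show "v \<in> G z"
      using \<alpha>W[OF z] vF by (simp add: G_def)
  qed
  have T_eq: "T z = {u. \<exists>v. \<alpha> *v u + \<sigma> *v v \<in> W z}" if z: "z \<in> X" for z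
  proof (intro set_eqI iffI CollectI)
    fix u assume "u \<in> T z"
    then obtain v w where u: "u = P z *v v + w" "v \<in> F2 z" "w \<in> F1 z"
      by (auto simp: T_def)
    have "\<alpha> *v w - (\<sigma> *v v - \<alpha> *v (P z *v v)) \<in> W z"
      using \<alpha>W[OF z] u(3) by (intro submodule_diff[OF R[OF z] SW[OF z] _ \<sigma>W[OF z u(2)]]) simp
    also have "\<alpha> *v w - (\<sigma> *v v - \<alpha> *v (P z *v v)) = \<alpha> *v u + \<sigma> *v (- v)"
      by (simp add: u(1) matrix_vector_right_distrib vec.neg)
    finally show "\<exists>v. \<alpha> *v u + \<sigma> *v v \<in> W z"
      by blast
  next
    fix u assume "u \<in> {u. \<exists>v. \<alpha> *v u + \<sigma> *v v \<in> W z}"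
    then obtain v where v: "\<alpha> *v u + \<sigma> *v v \<in> W z"
      by blast
    then have "\<beta> *v (\<alpha> *v u + \<sigma> *v v) \<in> F2 z"
      using ext(3)[OF z] by blast
    then have vF: "v \<in> F2 z"
      by (simp add: matrix_vector_right_distrib \<beta>\<alpha> \<beta>\<sigma>)
    have "(\<alpha> *v u + \<sigma> *v v) - (\<sigma> *v v - \<alpha> *v (P z *v v)) \<in> W z"
      by (rule submodule_diff[OF R[OF z] SW[OF z] v \<sigma>W[OF z vF]])
    also have "(\<alpha> *v u + \<sigma> *v v) - (\<sigma> *v v - \<alpha> *v (P z *v v)) = \<alpha> *v (u + P z *v v)"
      by (simp add: matrix_vector_right_distrib)
    finally have "u + P z *v v \<in> F1 z"
      using \<alpha>W[OF z] by blast
    moreover have "- v \<in> F2 z"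
      using submodule_diff[OF R[OF z] S2[OF z] submodule_zero[OF S2[OF z]] vF] by simp
    moreover have "u = P z *v (- v) + (u + P z *v v)"
      by (simp add: vec.neg)
    ultimately show "u \<in> T z"
      unfolding T_def by blast
  qed

  have P_hom: "P z *v v \<in> F1 z" if "z \<in> X" "z \<notin> range x" "v \<in> F2 z" for z v
    using a_hom[OF that(1,2)] that(3) by (simp add: Hstar hom_bundle_def P_def)
  have G_outside: "G z = F2 z" if "z \<in> X" "z \<notin> range x" for z
    using P_hom[OF that] by (auto simp: G_def)
  have T_sup: "F1 z \<subseteq> T z" if "z \<in> X" for z
  proof
    fix w assume "w \<in> F1 z"
    then have "P z *v 0 + w \<in> T z"
      unfolding T_def using submodule_zero[OF S2[OF that]] by blast
    then show "w \<in> T z"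
      by simp
  qed
  have T_outside: "T z = F1 z" if "z \<in> X" "z \<notin> range x" for z
  proof (rule subset_antisym[OF _ T_sup[OF that(1)]])
    show "T z \<subseteq> F1 z"
      using P_hom[OF that] submodule_add[OF S1[OF that(1)]] by (auto simp: T_def)
  qed

  \<comment> \<open>the local contributions to the weight of \<open>e\<close>\<close>
  define J where "J i = {j. e $ i $ j \<noteq> 0}" for i
  have D_x: "D (x i) = 1" for i
    using points(2) by (simp add: D point_sum_def inj_eq)
  have D_0: "D z = 0" if "z \<notin> range x" for z
    using that by (auto simp: D point_sum_def intro!: sum.neutral)
  have pole: "pole_along_line (x i) (F2 (x i)) (F1 (x i)) (as_matrix (p i j (x i)))" for i j
  proof -
    have "p i j (x i) \<in> twist D Hstar (x i)"
      using basis xX by (simp add: principal_part_basis_def)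
    then obtain t where t: "uniformizer (x i) t" "t *s p i j (x i) \<in> Hstar (x i)"
      using x_closed D_x by (auto simp: twist_def)
    show ?thesis
      using t rank_one[OF t(1), of j]
      by (intro pole_along_line_if_fibre_rank[OF dvr t(1)] S1 S2 xX) (auto simp: Hstar)
  qed
  have expansion: "P (x i) *v v - (\<Sum>j\<in>J i. \<iota> (e $ i $ j) *s (as_matrix (p i j (x i)) *v v)) \<in> F1 (x i)"
    if v: "v \<in> F2 (x i)" for i v
  proof -
    let ?b = "\<Sum>j\<in>J i. \<iota> (e $ i $ j) *s p i j (x i)"
    let ?c = "\<Sum>i'\<in>UNIV - {i}. \<Sum>j\<in>UNIV. \<iota> (e $ i' $ j) *s p i' j (x i)"
    have "(\<Sum>j\<in>UNIV. \<iota> (e $ i $ j) *s p i j (x i)) = ?b"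
      by (rule sum.mono_neutral_right) (auto simp: J_def field_embedding_zero[OF emb])
    then have "a (x i) = ?b + ?c"
      by (simp add: a_def word_prin_def sum.remove[of UNIV i])
    moreover have "?c \<in> Hstar (x i)"
      using points(2)
      by (intro submodule_sum[OF SH] submodule_scale[OF SH] const support xX) (auto simp: inj_eq)
    ultimately have "a (x i) - ?b \<in> Hstar (x i)"
      by simp
    then have "as_matrix (a (x i) - ?b) *v v \<in> F1 (x i)"
      using v by (simp add: Hstar hom_bundle_def)
    then show ?thesis
      by (simp add: P_def as_matrix_diff_vector as_matrix_sum_vector as_matrix_scale_vector)
  qed
  \<comment> \<open>at \<open>x i\<close> only the nonzero entries of \<open>e\<close> at \<open>x i\<close> contribute poles\<close>
  note local = sum_of_poles_local[OF dvr L1[OF xX] L2[OF xX] _ pole const[OF xX] expansion]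
  have G_x: "lattice_at (x i) (G (x i))"
    and G_order: "lattice_order (x i) (G (x i)) \<le> lattice_order (x i) (F2 (x i)) + int (card (J i))"
    and T_x: "lattice_at (x i) (T (x i))"
    and T_length: "quotient_length (x i) (*s) (F1 (x i)) (T (x i)) \<le> enat (card (J i))"
    and T_simple: "\<And>s v. s \<in> max_ideal (x i) \<Longrightarrow> v \<in> T (x i) \<Longrightarrow> s *s v \<in> F1 (x i)" for i
    unfolding G_def T_def by (rule local; simp)+

  have "vector_bundle X G"
    by (rule vector_bundle_modify[OF curve(1) bundles(2), of "range x"])
      (use points(1) G_outside G_x in auto)
  then have elementary: "elementary_transformation X G F2"
    by (auto simp: elementary_transformation_def G_def)
  have bundle_T: "vector_bundle X T"
    by (rule vector_bundle_modify[OF curve(1) bundles(1), of "range x"])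
      (use points(1) T_outside T_x in auto)

  have "T z \<subseteq> twist D F1 z" if z: "z \<in> X" for z
  proof (cases "z = UNIV \<or> z \<in> range x")
    case False
    then obtain t where "uniformizer z t"
      using curve_closed_point_dvr[OF curve(1) z] by (auto simp: discrete_valuation_ring_def)
    then show ?thesis
      using False z by (auto simp: twist_def D_0 T_outside)
  next
    case True
    show ?thesis
    proof (cases "z = UNIV")
      case True
      then have "T z = F1 z"
        using x_closed z by (intro T_outside) auto
      then show ?thesis
        using True by (simp add: twist_def)
    next
      case False
      with True obtain i where i: "z = x i"
        by auto
      obtain t where t: "uniformizer (x i) t"
        using dvr by (auto simp: discrete_valuation_ring_def)
      then have "t powi D (x i) *s v \<in> F1 (x i)" if "v \<in> T (x i)" for v
        using T_simple[OF uniformizer_in_max_ideal[OF t] that] by (simp add: D_x)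
      then show ?thesis
        using x_closed t by (auto simp: i twist_def)
    qed
  qed
  then have simple: "simple_pole_subsheaf X D F1 T"
    using T_sup submodule_image_plus[OF S2 S1] by (auto simp: simple_pole_subsheaf_def T_def)

  have "skyscraper_length X F1 T \<le> (\<Sum>z\<in>range x. quotient_length z (*s) (F1 z) (T z))"
    unfolding skyscraper_length_def by (rule sum_mono2) (use T_outside in auto)
  also have "\<dots> = (\<Sum>i\<in>UNIV. quotient_length (x i) (*s) (F1 (x i)) (T (x i)))"
    using points(2) by (simp add: sum.reindex)
  also have "\<dots> \<le> (\<Sum>i\<in>UNIV. enat (card (J i)))"
    by (intro sum_mono T_length)
  also have "\<dots> = enat (weight e)"
    by (simp add: weight_eq_sum J_def flip: of_nat_eq_enat)
  also have "\<dots> \<le> enat h"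
    using weight_e by simp
  finally have length: "skyscraper_length X F1 T \<le> enat h" .

  have sequence: "skyscraper_quotient_sequence X G F2 F1 T"
    unfolding skyscraper_quotient_sequence_def
    by (intro exI[of _ "\<lambda>z v. P z *v v"])
      (auto simp: G_def T_def matrix_vector_right_distrib matrix_vector_scale submodule_zero[OF S1])

  have "locally_free_quotient X W (\<lambda>z. (*v) \<sigma> ` {v. \<sigma> *v v \<in> W z})"
    using extension range_\<alpha>
    by (intro saturated_quotient_locally_free[OF curve(1) _ bundle_T \<alpha> \<beta>\<alpha> _ \<sigma> T_eq])
      (auto simp: is_extension_def)
  then have "locally_free_quotient X W (\<lambda>z. (*v) \<sigma> ` G z)"
    by (rule locally_free_quotient_cong) (simp add: G_eq)
  then have lifts: "lifts_to_subbundle X G W \<beta>"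
    using G_eq \<beta>\<sigma> by (auto simp: lifts_to_subbundle_def intro!: exI[of _ \<sigma>])

  have "bundle_degree \<iota> X G \<ge> bundle_degree \<iota> X F2 - (\<Sum>z\<in>range x. int (card (J (inv x z))))"
    by (rule bundle_degree_modify)
      (use xX x_closed point_degree_rational[OF curve(1) points(1)] G_outside G_order points(2) in auto)
  also have "(\<Sum>z\<in>range x. int (card (J (inv x z)))) = int (weight e)"
    using points(2) by (simp add: sum.reindex weight_eq_sum J_def)
  finally have degree: "bundle_degree \<iota> X G \<ge> bundle_degree \<iota> X F2 - int h"
    using weight_e by simp

  show "\<exists>G T. elementary_transformation X G F2 \<and> simple_pole_subsheaf X D F1 T \<and>
      skyscraper_length X F1 T \<le> enat h \<and> skyscraper_quotient_sequence X G F2 F1 T \<and>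
      lifts_to_subbundle X G W \<beta> \<and> bundle_degree \<iota> X G \<ge> bundle_degree \<iota> X F2 - int h"
    using elementary simple length sequence lifts degree by blast
qed

end
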